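(* Let $T>0$, $K>0$, $Q=[0,T]\times[-1,0]$, and let $\Sigma$ be a $\sigma$-algebra on $\mathfrak m_T$. The following conditions are equivalent: (i) For every $x\in AC([-1,T])$ and every $t\in[0,T]$, the mapping $$\mathfrak m_T\ni\mu\mapsto\int_0^t\int_{[-1,0]}x(\tau+s)\,d\mu_\tau(s)\,d\tau\in\mathbb R$$ is $(\Sigma,\mathfrak B(\mathbb R))$-measurable. (ii) The mapping $\mathfrak m_T\ni\mu\mapsto\nu(\mu)\in\mathcal M(Q)$ is $(\Sigma,\mathfrak B(\mathcal M(Q),w^* ))$-measurable. (iii) For every $z\in C(Q)$, the scalar mapping $\mathfrak m_T\ni\mu\mapsto\langle z,\nu(\mu)\rangle\in\mathbb R$ is $(\Sigma,\mathfrak B(\mathbb R))$-measurable.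
   Context: $\mathfrak B(S)$ is the Borel $\sigma$-algebra of a topological space $S$. Let $\mathfrak m$ be the set of finite signed Borel measures on $[-1,0]$ with total variation norm at most $K$. $\mathfrak m_T$ is the set of all maps $\mu:[0,T]\to\mathfrak m$, $t\mapsto\mu_t$, such that for every $f\in C([-1,0])$ the function $t\mapsto\int_{[-1,0]}f\,d\mu_t$ is Lebesgue measurable on $[0,T]$. $\mathcal M(Q)=C(Q)^*$ is the space of finite signed Borel measures on $Q$, $\langle z,\nu\rangle=\int_Q z\,d\nu$, and $\mathfrak B(\mathcal M(Q),w^* )$ is the Borel $\sigma$-algebra of the weak-* topology on $\mathcal M(Q)$. For $\mu\in\mathfrak m_T$, $\nu(\mu)\in\mathcal M(Q)$ is the finite signed measure $\nu(\mu)(A)=\int_0^T\mu_\tau(A_\tau)\,d\tau$, $A_\tau=\{s:(\tau,s)\in A\}$; equivalently $\int_Q\varphi\,d\nu(\mu)=\int_0^T\int_{[-1,0]}\varphi(\tau,s)\,d\mu_\tau(s)\,d\tau$ for $\varphi\in C(Q)$. $AC([-1,T])$ is the space of real absolutely continuous functions on $[-1,T]$. *)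

theory Defs
  imports "HOL-Analysis.Analysis"
begin

abbreviation borel_on :: "'a::topological_space set \<Rightarrow> 'a measure"
  where "borel_on S \<equiv> restrict_space borel S"

text \<open>
  Finite signed Borel measures on \<open>S\<close> are real-valued, countably additive set functions.
  As for \<^const>\<open>measure\<close>, the value outside the \<open>\<sigma>\<close>-algebra is fixed to be 0, so that two
  signed measures are equal as soon as they agree on the Borel sets.
\<close>

definition signed_measures :: "'a::topological_space set \<Rightarrow> ('a set \<Rightarrow> real) set"
  where "signed_measures S =
    {\<nu>. \<nu> {} = 0 \<and> (\<forall>A. A \<notin> sets (borel_on S) \<longrightarrow> \<nu> A = 0) \<and>
        (\<forall>A :: nat \<Rightarrow> 'a set. range A \<subseteq> sets (borel_on S) \<longrightarrow> disjoint_family A \<longrightarrow>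
           (\<lambda>n. \<nu> (A n)) sums \<nu> (\<Union>n. A n))}"

definition total_variation :: "'a::topological_space set \<Rightarrow> ('a set \<Rightarrow> real) \<Rightarrow> ennreal"
  where "total_variation S \<nu> =
    (SUP P \<in> {P. finite P \<and> disjoint P \<and> P \<subseteq> sets (borel_on S) \<and> \<Union>P = S}.
       \<Sum>A\<in>P. ennreal \<bar>\<nu> A\<bar>)"

text \<open>
  The positive part of the Jordan decomposition, \<open>A \<mapsto> sup {\<nu>(B) | B \<subseteq> A Borel}\<close>; \<^const>\<open>ennreal\<close>
  clips negative values to 0, which does not affect the supremum because of \<open>B = {}\<close>.
  The negative part is the positive part of \<open>-\<nu>\<close>.
\<close>

definition pos_part :: "'a::topological_space set \<Rightarrow> ('a set \<Rightarrow> real) \<Rightarrow> 'a measure"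
  where "pos_part S \<nu> = measure_of S (sets (borel_on S))
    (\<lambda>A. SUP B \<in> {B \<in> sets (borel_on S). B \<subseteq> A}. ennreal (\<nu> B))"

definition neg_part :: "'a::topological_space set \<Rightarrow> ('a set \<Rightarrow> real) \<Rightarrow> 'a measure"
  where "neg_part S \<nu> = pos_part S (\<lambda>A. - \<nu> A)"

definition signed_integral ::
    "'a::topological_space set \<Rightarrow> ('a set \<Rightarrow> real) \<Rightarrow> ('a \<Rightarrow> real) \<Rightarrow> real"
  where "signed_integral S \<nu> f = integral\<^sup>L (pos_part S \<nu>) f - integral\<^sup>L (neg_part S \<nu>) f"

definition weak_star :: "'a::topological_space set \<Rightarrow> ('a set \<Rightarrow> real) topology"
  where "weak_star S = topology_generated_by
    {{\<nu> \<in> signed_measures S. signed_integral S \<nu> z \<in> U} | z U. continuous_on S z \<and> open U}"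

definition borel_of_topology :: "'a topology \<Rightarrow> 'a measure"
  where "borel_of_topology X = sigma (topspace X) {U. openin X U}"

definition m_ball :: "real \<Rightarrow> (real set \<Rightarrow> real) set"
  where "m_ball K = {\<mu> \<in> signed_measures {-1..0}. total_variation {-1..0} \<mu> \<le> ennreal K}"

text \<open>
  Maps on \<open>[0,T]\<close> are total functions that are \<^const>\<open>undefined\<close> outside \<open>[0,T]\<close>.
\<close>

definition m_maps :: "real \<Rightarrow> real \<Rightarrow> (real \<Rightarrow> real set \<Rightarrow> real) set"
  where "m_maps T K = {\<mu> \<in> {0..T} \<rightarrow>\<^sub>E m_ball K.
    \<forall>f. continuous_on {-1..0} f \<longrightarrow>
      (\<lambda>t. signed_integral {-1..0} (\<mu> t) f) \<in> borel_measurable (lebesgue_on {0..T})}"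

definition Q_rect :: "real \<Rightarrow> (real \<times> real) set"
  where "Q_rect T = {0..T} \<times> {-1..0}"

definition nu :: "real \<Rightarrow> (real \<Rightarrow> real set \<Rightarrow> real) \<Rightarrow> (real \<times> real) set \<Rightarrow> real"
  where "nu T \<mu> A =
    (if A \<in> sets (borel_on (Q_rect T))
     then LINT \<tau>|lebesgue_on {0..T}. \<mu> \<tau> {s. (\<tau>, s) \<in> A}
     else 0)"

definition absolutely_continuous_fun_on :: "real set \<Rightarrow> (real \<Rightarrow> real) \<Rightarrow> bool"
  where "absolutely_continuous_fun_on I x \<longleftrightarrow>
    (\<forall>\<epsilon>>0. \<exists>\<delta>>0. \<forall>(n::nat) a b.
       (\<forall>k<n. a k \<le> b k \<and> {a k..b k} \<subseteq> I) \<longrightarrow>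
       disjoint_family_on (\<lambda>k. {a k<..<b k}) {..<n} \<longrightarrow>
       (\<Sum>k<n. b k - a k) < \<delta> \<longrightarrow>
       (\<Sum>k<n. \<bar>x (b k) - x (a k)\<bar>) < \<epsilon>)"

end

theory Submission
  imports Defs
begin

text \<open>
  All three conditions say that enough scalar functions of \<open>\<mu>\<close> are measurable. The bridge between them
  is the identity \<open>\<integral> \<phi> d\<nu>(\<mu>) = \<integral>\<^sub>0\<^sup>T \<integral> \<phi>(\<tau>,s) d\<mu>\<^sub>\<tau>(s) d\<tau>\<close> for continuous \<open>\<phi>\<close>
  (\<open>nu_fubini_continuous\<close>), together with the fact that all measures \<open>\<nu>(\<mu>)\<close> lie in one bounded
  set, with values at most \<open>K T\<close> (\<open>nu_signed_measures_le\<close>).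

  The delicate implication is the one to (ii), where preimages of arbitrary weak-* open sets must be
  measurable. On a bounded set of measures the weak-* topology is second countable: by
  Stone-Weierstrass and the uniform bound, it is determined by the integrals of countably many functions whose span is the space
  of polynomials (\<open>weak_star_open_moments\<close>). Hence it is enough to know that these countably
  many moments are measurable in \<open>\<mu>\<close> (\<open>measurable_weak_star_of_moments\<close>).

  To reach the moments from (i), the polynomials are spanned by \<open>\<tau>\<^sup>i (\<tau> + s)\<^sup>j\<close>. The powers of \<open>\<tau> + s\<close> are
  absolutely continuous functions as in (i), and since (i) holds for every upper limit \<open>t\<close> of
  the outer integral, a further weight depending on \<open>\<tau>\<close> alone can be inserted
  (\<open>weighted_integral_measurable\<close>). The way back from (iii) to (i) uses continuous
  approximations of the indicator of \<open>[0,t]\<close>, and (ii) implies (iii) because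
  integration against a continuous function is weak-* continuous.
\<close>

section \<open>Signed measures with uniformly bounded values\<close>

text \<open>
  Up to a factor 2, a uniform bound on the values of a signed measure is the same as a bound on its
  total variation. The former is what the proof uses: it controls both Jordan parts, and for the
  integrated measure it follows at once from the bound on each kernel, by integration.
\<close>

definition signed_measures_le :: "'a::topological_space set \<Rightarrow> real \<Rightarrow> ('a set \<Rightarrow> real) set"
  where "signed_measures_le S R =
    {\<nu> \<in> signed_measures S. \<forall>A\<in>sets (borel_on S). \<bar>\<nu> A\<bar> \<le> R}"

lemma signed_measures_leD:
  assumes "\<nu> \<in> signed_measures_le S R"
  shows "\<nu> \<in> signed_measures S" and "A \<in> sets (borel_on S) \<Longrightarrow> \<bar>\<nu> A\<bar> \<le> R"
  using assms by (auto simp: signed_measures_le_def)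

lemma space_borel_on [simp]: "space (borel_on S) = S"
  by (simp add: space_restrict_space)

lemma signed_measure_empty: "\<nu> \<in> signed_measures S \<Longrightarrow> \<nu> {} = 0"
  by (simp add: signed_measures_def)

lemma signed_measure_sums:
  assumes "\<nu> \<in> signed_measures S" "range A \<subseteq> sets (borel_on S)" "disjoint_family A"
  shows "(\<lambda>n. \<nu> (A n)) sums \<nu> (\<Union>n. A n)"
  using assms by (simp add: signed_measures_def)

lemma signed_measure_Un:
  assumes "\<nu> \<in> signed_measures S" "A \<in> sets (borel_on S)" "B \<in> sets (borel_on S)" "A \<inter> B = {}"
  shows "\<nu> (A \<union> B) = \<nu> A + \<nu> B"
proof -
  have "(\<lambda>n. \<nu> (binaryset A B n)) sums \<nu> (\<Union>n. binaryset A B n)"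
    using assms
    by (intro signed_measure_sums) (auto simp: range_binaryset_eq disjoint_family_on_def binaryset_def)
  moreover have "(\<lambda>n. \<nu> (binaryset A B n)) sums (\<nu> A + \<nu> B)"
    using assms(1) by (intro binaryset_sums) (rule signed_measure_empty)
  ultimately show ?thesis
    by (simp add: UN_binaryset_eq sums_unique2)
qed

lemma signed_measure_Diff:
  assumes "\<nu> \<in> signed_measures S" "A \<in> sets (borel_on S)" "B \<in> sets (borel_on S)" "B \<subseteq> A"
  shows "\<nu> (A - B) = \<nu> A - \<nu> B"
proof -
  have "\<nu> (B \<union> (A - B)) = \<nu> B + \<nu> (A - B)"
    using assms by (intro signed_measure_Un) auto
  moreover have "B \<union> (A - B) = A" using assms by auto
  ultimately show ?thesis by simp
qed

lemma uminus_signed_measures: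
  assumes "\<nu> \<in> signed_measures S" shows "(\<lambda>A. - \<nu> A) \<in> signed_measures S"
  using assms by (auto simp: signed_measures_def intro: sums_minus)

lemma uminus_signed_measures_le:
  assumes "\<nu> \<in> signed_measures_le S R" shows "(\<lambda>A. - \<nu> A) \<in> signed_measures_le S R"
  using assms by (auto simp: signed_measures_le_def intro: uminus_signed_measures)

section \<open>The Jordan parts and the integral\<close>

lemma sets_pos_part [simp, measurable_cong]: "sets (pos_part S \<nu>) = sets (borel_on S)"
  unfolding pos_part_def using sets.sigma_sets_eq[of "borel_on S"] sets.space_closed[of "borel_on S"]
  by (simp add: sets_measure_of)

lemma space_pos_part [simp]: "space (pos_part S \<nu>) = S"
  unfolding pos_part_def using sets.space_closed[of "borel_on S"]
  by (simp add: space_measure_of)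

text \<open>
  The positive part is the supremum of the signed measure over Borel subsets. It is a measure for
  the following reason. If \<open>B\<close> and \<open>B'\<close> lie in disjoint sets, \<open>\<nu>\<close> adds up over
  \<open>B \<union> B'\<close>, so the supremum is superadditive, hence countably superadditive. Conversely, a
  subset \<open>B\<close> of a disjoint union splits into its traces, and \<open>\<nu> B\<close> is the sum of their values.
\<close>

lemma emeasure_pos_part:
  assumes \<nu>: "\<nu> \<in> signed_measures S" and A: "A \<in> sets (borel_on S)"
  shows "emeasure (pos_part S \<nu>) A = (SUP B \<in> {B \<in> sets (borel_on S). B \<subseteq> A}. ennreal (\<nu> B))"
proof -
  define p where "p A = (SUP B \<in> {B \<in> sets (borel_on S). B \<subseteq> A}. ennreal (\<nu> B))" for A
  have ub: "ennreal (\<nu> B) \<le> p A" if "B \<in> sets (borel_on S)" "B \<subseteq> A" for A B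
    unfolding p_def using that by (intro SUP_upper) auto
  have p_empty: "p {} = 0"
    using signed_measure_empty[OF \<nu>] by (auto simp: p_def intro!: SUP_eqI)
  have mono: "p A \<le> p A'" if "A \<subseteq> A'" for A A'
    unfolding p_def using that by (intro SUP_subset_mono) auto
  have super: "p A + p A' \<le> p (A \<union> A')" if disj: "A \<inter> A' = {}" for A A'
  proof -
    have "ennreal (\<nu> B) + ennreal (\<nu> B') \<le> p (A \<union> A')"
      if B: "B \<in> sets (borel_on S)" "B \<subseteq> A" and B': "B' \<in> sets (borel_on S)" "B' \<subseteq> A'" for B B'
    proof -
      have "ennreal (\<nu> B) + ennreal (\<nu> B') = ennreal (\<nu> (B \<union> B'))" if "\<nu> B \<ge> 0" "\<nu> B' \<ge> 0"
      proof -
        have "B \<inter> B' = {}" using B B' disj by auto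
        then show ?thesis using signed_measure_Un[OF \<nu>, of B B'] B B' that by (simp add: ennreal_plus)
      qed
      \<comment> \<open>A set of negative value counts as 0, so it may be replaced by the empty set.\<close>
      moreover have "ennreal (\<nu> B) \<le> p (A \<union> A')" "ennreal (\<nu> B') \<le> p (A \<union> A')"
        "ennreal (\<nu> (B \<union> B')) \<le> p (A \<union> A')"
        using B B' by (auto intro!: ub)
      ultimately show ?thesis
        by (cases "\<nu> B \<ge> 0"; cases "\<nu> B' \<ge> 0") (auto simp: ennreal_neg)
    qed
    then have "ennreal (\<nu> B) + p A' \<le> p (A \<union> A')" if "B \<in> sets (borel_on S)" "B \<subseteq> A" for B
      unfolding p_def[of A'] using that by (subst ennreal_SUP_add_right) (auto intro!: SUP_least)
    then show ?thesis
      unfolding p_def[of A] by (subst ennreal_SUP_add_left[symmetric]) (auto intro!: SUP_least)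
  qed
  have "countably_additive (sets (borel_on S)) p"
  proof (rule countably_additiveI)
    fix F :: "nat \<Rightarrow> 'a set"
    assume F: "range F \<subseteq> sets (borel_on S)" "disjoint_family F" "(\<Union>i. F i) \<in> sets (borel_on S)"
    have fin: "(\<Sum>i<n. p (F i)) \<le> p (\<Union>i<n. F i)" for n
    proof (induction n)
      case (Suc n)
      have "(\<Sum>i<Suc n. p (F i)) \<le> p (\<Union>i<n. F i) + p (F n)"
        using Suc by (simp add: add_right_mono)
      also have "\<dots> \<le> p ((\<Union>i<n. F i) \<union> F n)"
      proof (rule super)
        have "F i \<inter> F n = {}" if "i < n" for i
          using disjoint_family_onD[OF F(2), of i n] that by auto
        then show "(\<Union>i<n. F i) \<inter> F n = {}" by blast
      qed
      also have "(\<Union>i<n. F i) \<union> F n = (\<Union>i<Suc n. F i)"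
        by (auto simp: less_Suc_eq)
      finally show ?case .
    qed (simp add: p_empty)
    have "(\<Sum>i. p (F i)) \<le> p (\<Union>i. F i)"
      by (intro suminf_le_const summableI, rule order_trans[OF fin], rule mono) auto
    moreover have "p (\<Union>i. F i) \<le> (\<Sum>i. p (F i))"
      unfolding p_def[of "\<Union>i. F i"]
    proof (intro SUP_least, clarify)
      fix B assume B: "B \<in> sets (borel_on S)" "B \<subseteq> (\<Union>i. F i)"
      have BF: "B \<inter> F i \<in> sets (borel_on S)" for i using F B by auto
      have "(\<lambda>i. \<nu> (B \<inter> F i)) sums \<nu> (\<Union>i. B \<inter> F i)"
        using F(2) BF by (intro signed_measure_sums[OF \<nu>]) (auto simp: disjoint_family_on_def)
      also have "(\<Union>i. B \<inter> F i) = B" using B by auto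
      finally have s: "(\<lambda>n. \<Sum>i<n. \<nu> (B \<inter> F i)) \<longlonglongrightarrow> \<nu> B" by (simp add: sums_def)
      have "ennreal (\<Sum>i<n. \<nu> (B \<inter> F i)) \<le> (\<Sum>i. p (F i))" for n
      proof -
        have "ennreal (\<Sum>i<n. \<nu> (B \<inter> F i)) \<le> ennreal (\<Sum>i<n. max 0 (\<nu> (B \<inter> F i)))"
          by (intro ennreal_leI sum_mono) auto
        also have "\<dots> = (\<Sum>i<n. ennreal (\<nu> (B \<inter> F i)))"
          by (subst sum_ennreal[symmetric], simp, intro sum.cong) (auto simp: max_def ennreal_neg)
        also have "\<dots> \<le> (\<Sum>i<n. p (F i))"
          using BF by (intro sum_mono ub) auto
        also have "\<dots> \<le> (\<Sum>i. p (F i))" by (intro sum_le_suminf) auto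
        finally show ?thesis .
      qed
      then show "ennreal (\<nu> B) \<le> (\<Sum>i. p (F i))"
        by (intro LIMSEQ_le_const2[OF tendsto_ennrealI[OF s]]) auto
    qed
    ultimately show "(\<Sum>i. p (F i)) = p (\<Union>i. F i)" by (rule antisym)
  qed
  moreover have "positive (sets (borel_on S)) p"
    by (simp add: positive_def p_empty)
  moreover have "sigma_algebra S (sets (borel_on S))"
    using sets.sigma_algebra_axioms[of "borel_on S"] by simp
  ultimately have "emeasure (measure_of S (sets (borel_on S)) p) A = p A"
    using A by (intro emeasure_measure_of_sigma)
  then show ?thesis unfolding pos_part_def p_def[abs_def] .
qed

lemma pos_part_le:
  assumes "\<nu> \<in> signed_measures_le S R"
  shows "finite_measure (pos_part S \<nu>)" "measure (pos_part S \<nu>) S \<le> R"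
proof -
  note \<nu> = signed_measures_leD[OF assms]
  have "\<bar>\<nu> {}\<bar> \<le> R" by (intro \<nu>) auto
  then have R: "0 \<le> R" by simp
  have S: "S \<in> sets (borel_on S)" using sets.top[of "borel_on S"] by simp
  have le: "emeasure (pos_part S \<nu>) S \<le> ennreal R"
    unfolding emeasure_pos_part[OF \<nu>(1) S]
    using \<nu>(2) by (intro SUP_least ennreal_leI) (auto simp: abs_le_iff)
  then show "finite_measure (pos_part S \<nu>)"
    by (intro finite_measureI) (auto simp: top_unique)
  show "measure (pos_part S \<nu>) S \<le> R"
    using le R by (simp add: measure_def enn2real_leI)
qed

lemma le_measure_pos_part:
  assumes "\<nu> \<in> signed_measures_le S R" "A \<in> sets (borel_on S)" "B \<in> sets (borel_on S)" "B \<subseteq> A"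
  shows "\<nu> B \<le> measure (pos_part S \<nu>) A"
proof -
  interpret finite_measure "pos_part S \<nu>" by (rule pos_part_le[OF assms(1)])
  have "ennreal (\<nu> B) \<le> emeasure (pos_part S \<nu>) A"
    using assms by (subst emeasure_pos_part) (auto intro!: SUP_upper dest: signed_measures_leD)
  then show ?thesis by (simp add: emeasure_eq_measure)
qed

lemma measure_pos_part_le:
  assumes "\<nu> \<in> signed_measures_le S R" "A \<in> sets (borel_on S)" 
    "\<And>B. B \<in> sets (borel_on S) \<Longrightarrow> B \<subseteq> A \<Longrightarrow> \<nu> B \<le> c"
  shows "measure (pos_part S \<nu>) A \<le> c"
proof -
  note \<nu> = signed_measures_leD[OF assms(1)]
  have "0 \<le> c" using assms(3)[of "{}"] signed_measure_empty[OF \<nu>(1)] by simp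
  moreover have "emeasure (pos_part S \<nu>) A \<le> ennreal c"
    unfolding emeasure_pos_part[OF \<nu>(1) assms(2)]
    by (intro SUP_least ennreal_leI) (auto intro: assms(3))
  ultimately show ?thesis by (simp add: measure_def enn2real_leI)
qed

text \<open>
  For Borel \<open>B \<subseteq> A\<close> we have \<open>\<nu> B = \<nu> A - \<nu> (A - B)\<close>, and \<open>- \<nu> (A - B)\<close> is at most the negative part of
  \<open>A\<close>. Taking the supremum over \<open>B\<close>, for \<open>\<nu>\<close> and for \<open>-\<nu>\<close>, gives the two inequalities of the Jordan
  decomposition. Finiteness of both parts makes the difference meaningful.
\<close>

lemma measure_pos_part_diff_neg_part:
  assumes \<nu>: "\<nu> \<in> signed_measures_le S R" and A: "A \<in> sets (borel_on S)"
  shows "measure (pos_part S \<nu>) A - measure (neg_part S \<nu>) A = \<nu> A"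
proof -
  note \<nu>' = uminus_signed_measures_le[OF \<nu>]
  have d: "\<nu> (A - B) = \<nu> A - \<nu> B" if "B \<in> sets (borel_on S)" "B \<subseteq> A" for B
    by (rule signed_measure_Diff[OF signed_measures_leD(1)[OF \<nu>] A that])
  have "measure (pos_part S \<nu>) A \<le> \<nu> A + measure (neg_part S \<nu>) A"
  proof (rule measure_pos_part_le[OF \<nu> A])
    fix B assume B: "B \<in> sets (borel_on S)" "B \<subseteq> A"
    show "\<nu> B \<le> \<nu> A + measure (neg_part S \<nu>) A"
      using le_measure_pos_part[OF \<nu>' A sets.Diff[OF A B(1)] Diff_subset] d[OF B]
      unfolding neg_part_def by linarith
  qed
  moreover have "measure (neg_part S \<nu>) A \<le> - \<nu> A + measure (pos_part S \<nu>) A"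
    unfolding neg_part_def
  proof (rule measure_pos_part_le[OF \<nu>' A])
    fix B assume B: "B \<in> sets (borel_on S)" "B \<subseteq> A"
    show "- \<nu> B \<le> - \<nu> A + measure (pos_part S \<nu>) A"
      using le_measure_pos_part[OF \<nu> A sets.Diff[OF A B(1)] Diff_subset] d[OF B] by linarith
  qed
  ultimately show ?thesis by simp
qed

lemma sets_neg_part [simp, measurable_cong]: "sets (neg_part S \<nu>) = sets (borel_on S)"
  and space_neg_part [simp]: "space (neg_part S \<nu>) = S"
  by (simp_all add: neg_part_def)

lemma neg_part_le:
  assumes "\<nu> \<in> signed_measures_le S R"
  shows "finite_measure (neg_part S \<nu>)" "measure (neg_part S \<nu>) S \<le> R"
  using pos_part_le[OF uminus_signed_measures_le[OF assms]] by (simp_all add: neg_part_def)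

lemma integrable_parts:
  fixes f :: "'a::topological_space \<Rightarrow> real"
  assumes \<nu>: "\<nu> \<in> signed_measures_le S R"
    and f: "f \<in> borel_measurable (borel_on S)" "\<And>x. x \<in> S \<Longrightarrow> \<bar>f x\<bar> \<le> C"
  shows "integrable (pos_part S \<nu>) f" "integrable (neg_part S \<nu>) f"
proof -
  interpret p: finite_measure "pos_part S \<nu>" by (rule pos_part_le[OF \<nu>])
  interpret n: finite_measure "neg_part S \<nu>" by (rule neg_part_le[OF \<nu>])
  show "integrable (pos_part S \<nu>) f"
    by (rule p.integrable_const_bound[of _ C]) (use f in \<open>auto intro!: AE_I2\<close>)
  show "integrable (neg_part S \<nu>) f"
    by (rule n.integrable_const_bound[of _ C]) (use f in \<open>auto intro!: AE_I2\<close>)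
qed

lemma signed_integral_cong:
  assumes "\<And>x. x \<in> S \<Longrightarrow> f x = g x"
  shows "signed_integral S \<nu> f = signed_integral S \<nu> g"
proof -
  have "integral\<^sup>L (pos_part S \<nu>) f = integral\<^sup>L (pos_part S \<nu>) g"
    by (rule Bochner_Integration.integral_cong) (use assms in auto)
  moreover have "integral\<^sup>L (neg_part S \<nu>) f = integral\<^sup>L (neg_part S \<nu>) g"
    by (rule Bochner_Integration.integral_cong) (use assms in auto)
  ultimately show ?thesis by (simp add: signed_integral_def)
qed

lemma signed_integral_indicator:
  assumes \<nu>: "\<nu> \<in> signed_measures_le S R" and A: "A \<in> sets (borel_on S)"
  shows "signed_integral S \<nu> (indicator A) = \<nu> A"
proof -
  interpret p: finite_measure "pos_part S \<nu>" by (rule pos_part_le[OF \<nu>])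
  interpret n: finite_measure "neg_part S \<nu>" by (rule neg_part_le[OF \<nu>])
  have "A \<subseteq> S" using sets.sets_into_space[OF A] by simp
  then have "A \<inter> S = A" by auto
  then show ?thesis
    using measure_pos_part_diff_neg_part[OF \<nu> A] by (simp add: signed_integral_def)
qed

lemma signed_integral_add:
  fixes f g :: "'a::topological_space \<Rightarrow> real"
  assumes \<nu>: "\<nu> \<in> signed_measures_le S R"
    and f: "f \<in> borel_measurable (borel_on S)" "\<And>x. x \<in> S \<Longrightarrow> \<bar>f x\<bar> \<le> C"
    and g: "g \<in> borel_measurable (borel_on S)" "\<And>x. x \<in> S \<Longrightarrow> \<bar>g x\<bar> \<le> D"
  shows "signed_integral S \<nu> (\<lambda>x. f x + g x) = signed_integral S \<nu> f + signed_integral S \<nu> g"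
  using integrable_parts[OF \<nu> f] integrable_parts[OF \<nu> g] by (simp add: signed_integral_def)

lemma signed_integral_cmult:
  "signed_integral S \<nu> (\<lambda>x. c * f x) = c * signed_integral S \<nu> f"
  by (simp add: signed_integral_def algebra_simps)

lemma signed_integral_diff:
  fixes f g :: "'a::topological_space \<Rightarrow> real"
  assumes \<nu>: "\<nu> \<in> signed_measures_le S R"
    and f: "f \<in> borel_measurable (borel_on S)" "\<And>x. x \<in> S \<Longrightarrow> \<bar>f x\<bar> \<le> C"
    and g: "g \<in> borel_measurable (borel_on S)" "\<And>x. x \<in> S \<Longrightarrow> \<bar>g x\<bar> \<le> D"
  shows "signed_integral S \<nu> (\<lambda>x. f x - g x) = signed_integral S \<nu> f - signed_integral S \<nu> g"
  using integrable_parts[OF \<nu> f] integrable_parts[OF \<nu> g] by (simp add: signed_integral_def)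

lemma integral_abs_bound_const:
  fixes f :: "'a \<Rightarrow> real"
  assumes "finite_measure M" "f \<in> borel_measurable M" "\<And>x. x \<in> space M \<Longrightarrow> \<bar>f x\<bar> \<le> C"
  shows "\<bar>LINT x|M. f x\<bar> \<le> C * measure M (space M)"
proof -
  interpret finite_measure M by fact
  have i: "integrable M f"
    by (rule integrable_const_bound[of _ C]) (use assms in \<open>auto intro!: AE_I2\<close>)
  have "\<bar>LINT x|M. f x\<bar> \<le> (LINT x|M. \<bar>f x\<bar>)" by (rule integral_abs_bound)
  also have "\<dots> \<le> (LINT x|M. C)"
    using i assms(3) by (intro integral_mono) auto
  finally show ?thesis by (simp add: mult.commute)
qed

text \<open>
  Each Jordan part has mass at most \<open>R\<close>, which explains the factor 2. It is harmless, since the estimate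
  only serves to show that uniform approximation of the integrand is uniform over the whole ball.
\<close>

lemma signed_integral_bound:
  assumes \<nu>: "\<nu> \<in> signed_measures_le S R"
    and f: "f \<in> borel_measurable (borel_on S)" "\<And>x. x \<in> S \<Longrightarrow> \<bar>f x\<bar> \<le> C" and C: "0 \<le> C"
  shows "\<bar>signed_integral S \<nu> f\<bar> \<le> 2 * R * C"
proof -
  have "\<bar>integral\<^sup>L (pos_part S \<nu>) f\<bar> \<le> C * measure (pos_part S \<nu>) (space (pos_part S \<nu>))"
    using f by (intro integral_abs_bound_const pos_part_le[OF \<nu>]) auto
  also have "\<dots> \<le> C * R" using C pos_part_le[OF \<nu>] by (auto intro: mult_left_mono)
  finally have 1: "\<bar>integral\<^sup>L (pos_part S \<nu>) f\<bar> \<le> C * R" .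
  have "\<bar>integral\<^sup>L (neg_part S \<nu>) f\<bar> \<le> C * measure (neg_part S \<nu>) (space (neg_part S \<nu>))"
    using f by (intro integral_abs_bound_const neg_part_le[OF \<nu>]) auto
  also have "\<dots> \<le> C * R" using C neg_part_le[OF \<nu>] by (auto intro: mult_left_mono)
  finally have "\<bar>integral\<^sup>L (neg_part S \<nu>) f\<bar> \<le> C * R" .
  with 1 have "\<bar>signed_integral S \<nu> f\<bar> \<le> C * R + C * R"
    unfolding signed_integral_def by linarith
  also have "C * R + C * R = 2 * R * C" by algebra
  finally show ?thesis .
qed

lemma signed_integral_tendsto:
  assumes \<nu>: "\<nu> \<in> signed_measures_le S R"
    and f: "\<And>n. f n \<in> borel_measurable (borel_on S)" "\<And>n x. x \<in> S \<Longrightarrow> \<bar>f n x\<bar> \<le> C"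
    and lim: "\<And>x. x \<in> S \<Longrightarrow> (\<lambda>n. f n x) \<longlonglongrightarrow> g x"
  shows "(\<lambda>n. signed_integral S \<nu> (f n)) \<longlonglongrightarrow> signed_integral S \<nu> g"
proof -
  interpret p: finite_measure "pos_part S \<nu>" by (rule pos_part_le[OF \<nu>])
  interpret n: finite_measure "neg_part S \<nu>" by (rule neg_part_le[OF \<nu>])
  have g: "g \<in> borel_measurable (borel_on S)"
    by (rule borel_measurable_LIMSEQ_real[where u = f, OF _ f(1)]) (simp add: lim)
  show ?thesis
    unfolding signed_integral_def
  proof (intro tendsto_diff)
    show "(\<lambda>n. integral\<^sup>L (pos_part S \<nu>) (f n)) \<longlonglongrightarrow> integral\<^sup>L (pos_part S \<nu>) g"
      by (rule integral_dominated_convergence[where w = "\<lambda>_. C"])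
        (use f g lim in \<open>auto intro!: AE_I2\<close>)
    show "(\<lambda>n. integral\<^sup>L (neg_part S \<nu>) (f n)) \<longlonglongrightarrow> integral\<^sup>L (neg_part S \<nu>) g"
      by (rule integral_dominated_convergence[where w = "\<lambda>_. C"])
        (use f g lim in \<open>auto intro!: AE_I2\<close>)
  qed
qed

section \<open>Measurability of the kernels on Borel sets\<close>

text \<open>
  Continuous functions decreasing to the indicator of a half-line: equal to 1 up to \<open>a\<close>, and falling with slope
  \<open>-n\<close> to 0 after it. They transfer measurability from continuous integrands to half-lines, once in the
  delay variable \<open>s\<close> and once in the time variable \<open>\<tau>\<close>.
\<close>

definition cutoff :: "nat \<Rightarrow> real \<Rightarrow> real \<Rightarrow> real"
  where "cutoff n a x = max 0 (min 1 (1 - real n * (x - a)))"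

lemma cutoff_bounds: "0 \<le> cutoff n a x" "\<bar>cutoff n a x\<bar> \<le> 1"
  by (auto simp: cutoff_def)

lemma continuous_on_cutoff [continuous_intros]:
  "continuous_on A f \<Longrightarrow> continuous_on A (\<lambda>x. cutoff n a (f x))"
  unfolding cutoff_def by (intro continuous_intros)

lemma cutoff_tendsto: "(\<lambda>n. cutoff n a x) \<longlonglongrightarrow> indicator {..a} x"
proof (cases "x \<le> a")
  case True
  then have "cutoff n a x = 1" for n
    by (auto simp: cutoff_def mult_nonneg_nonpos)
  then show ?thesis using True by simp
next
  case False
  obtain N :: nat where N: "1 / (x - a) < N" using reals_Archimedean2 by blast
  have "eventually (\<lambda>n. cutoff n a x = 0) sequentially"
    using eventually_ge_at_top[of N]
  proof eventually_elim
    case (elim n)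
    have "1 \<le> real N * (x - a)" using N False by (simp add: field_simps)
    also have "\<dots> \<le> real n * (x - a)" using elim False by (intro mult_right_mono) auto
    finally show ?case by (simp add: cutoff_def)
  qed
  then show ?thesis using False by (simp add: tendsto_eventually)
qed

text \<open>
  A Borel set and its complement form a partition, so the total variation dominates each single value.
\<close>

lemma m_ball_le:
  assumes "\<mu> \<in> m_ball K" "0 \<le> K"
  shows "\<mu> \<in> signed_measures_le {-1..0} K"
proof -
  let ?S = "{-1..0::real}"
  have \<mu>: "\<mu> \<in> signed_measures ?S" "total_variation ?S \<mu> \<le> ennreal K"
    using assms(1) by (auto simp: m_ball_def)
  have "\<bar>\<mu> A\<bar> \<le> K" if A: "A \<in> sets (borel_on ?S)" for A
  proof -
    have AS: "A \<subseteq> ?S" using sets.sets_into_space[OF A] by simp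
    have top: "?S \<in> sets (borel_on ?S)" using sets.top[of "borel_on ?S"] by simp
    let ?P = "{A, ?S - A}"
    have "ennreal \<bar>\<mu> A\<bar> = (\<Sum>B\<in>{A}. ennreal \<bar>\<mu> B\<bar>)" by simp
    also have "\<dots> \<le> (\<Sum>B\<in>?P. ennreal \<bar>\<mu> B\<bar>)" by (intro sum_mono2) auto
    also have "\<dots> \<le> total_variation ?S \<mu>"
      unfolding total_variation_def
      using A AS sets.Diff[OF top A] by (intro SUP_upper) (auto simp: disjoint_def)
    also note \<mu>(2)
    finally show ?thesis using assms(2) by simp
  qed
  then show ?thesis using \<mu> by (simp add: signed_measures_le_def)
qed

lemma m_mapsD:
  assumes "\<mu> \<in> m_maps T K"
  shows "0 \<le> K \<Longrightarrow> \<tau> \<in> {0..T} \<Longrightarrow> \<mu> \<tau> \<in> signed_measures_le {-1..0} K"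
    and "continuous_on {-1..0} f \<Longrightarrow>
      (\<lambda>\<tau>. signed_integral {-1..0} (\<mu> \<tau>) f) \<in> borel_measurable (lebesgue_on {0..T})"
  using assms by (auto simp: m_maps_def intro: m_ball_le)

lemma signed_measure_sum_lessThan:
  fixes F :: "nat \<Rightarrow> 'a::topological_space set"
  assumes \<nu>: "\<nu> \<in> signed_measures S" and F: "\<And>i. F i \<in> sets (borel_on S)" "disjoint_family F"
  shows "(\<Sum>i<n. \<nu> (F i)) = \<nu> (\<Union>i<n. F i)"
proof (induction n)
  case (Suc n)
  have "F i \<inter> F n = {}" if "i < n" for i
    using disjoint_family_onD[OF F(2), of i n] that by auto
  then have "\<nu> ((\<Union>i<n. F i) \<union> F n) = \<nu> (\<Union>i<n. F i) + \<nu> (F n)"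
    using F(1) by (intro signed_measure_Un[OF \<nu>]) auto
  moreover have "(\<Union>i<Suc n. F i) = (\<Union>i<n. F i) \<union> F n" by (auto simp: less_Suc_eq)
  ultimately show ?case using Suc by simp
qed (simp add: signed_measure_empty[OF \<nu>])

lemma sets_section:
  assumes "A \<in> sets (borel :: (real \<times> real) measure)"
  shows "S \<inter> Pair \<tau> -` A \<in> sets (borel_on S)"
proof -
  have "Pair \<tau> -` A \<in> sets borel"
    by (rule sets_Pair1[OF assms[folded borel_prod]])
  then show ?thesis by (auto simp: sets_restrict_space)
qed

lemma borel_measurable_section:
  assumes "f \<in> borel_measurable (borel :: (real \<times> real) measure)"
  shows "(\<lambda>s. f (\<tau>, s)) \<in> borel_measurable (borel_on S)"
proof -
  have "(\<lambda>s. (\<tau>, s)) \<in> borel \<rightarrow>\<^sub>M (borel :: (real \<times> real) measure)"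
    by (intro borel_measurable_continuous_onI continuous_intros)
  from measurable_compose[OF this assms] show ?thesis
    by (rule measurable_restrict_space1)
qed

text \<open>
  On a half-line, \<open>\<mu> \<tau>\<close> is the limit of its integrals over continuous cutoffs, which are measurable in
  \<open>\<tau>\<close> by the definition of the space of kernels. Restricting \<open>\<tau>\<close> to another half-line multiplies by an
  indicator.
\<close>

lemma kernel_measurable_lower_orthant:
  assumes \<mu>: "\<mu> \<in> m_maps T K" and K: "0 \<le> K"
  shows "(\<lambda>\<tau>. \<mu> \<tau> ({-1..0} \<inter> Pair \<tau> -` {..(a, b)})) \<in> borel_measurable (lebesgue_on {0..T})"
proof -
  let ?S = "{-1..0::real}"
  have top: "?S \<inter> {..b} \<in> sets (borel_on ?S)" by (auto simp: sets_restrict_space)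
  have lim: "(\<lambda>n. signed_integral ?S (\<mu> \<tau>) (cutoff n b)) \<longlonglongrightarrow> \<mu> \<tau> (?S \<inter> {..b})"
    if \<tau>: "\<tau> \<in> {0..T}" for \<tau>
  proof -
    note \<mu>\<tau> = m_mapsD(1)[OF \<mu> K \<tau>]
    have "(\<lambda>n. signed_integral ?S (\<mu> \<tau>) (cutoff n b)) \<longlonglongrightarrow> signed_integral ?S (\<mu> \<tau>) (indicator {..b})"
      by (intro signed_integral_tendsto[OF \<mu>\<tau>, where C = 1] cutoff_tendsto cutoff_bounds
          measurable_restrict_space1 borel_measurable_continuous_onI continuous_intros)
    also have "signed_integral ?S (\<mu> \<tau>) (indicator {..b}) = signed_integral ?S (\<mu> \<tau>) (indicator (?S \<inter> {..b}))"
      by (intro signed_integral_cong) (auto simp: indicator_def)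
    also have "\<dots> = \<mu> \<tau> (?S \<inter> {..b})" by (rule signed_integral_indicator[OF \<mu>\<tau> top])
    finally show ?thesis .
  qed
  have m: "(\<lambda>\<tau>. \<mu> \<tau> (?S \<inter> {..b})) \<in> borel_measurable (lebesgue_on {0..T})"
  proof (rule borel_measurable_LIMSEQ_real)
    show "(\<lambda>\<tau>. signed_integral ?S (\<mu> \<tau>) (cutoff n b)) \<in> borel_measurable (lebesgue_on {0..T})" for n
      by (intro m_mapsD(2)[OF \<mu>] continuous_intros)
    show "(\<lambda>n. signed_integral ?S (\<mu> \<tau>) (cutoff n b)) \<longlonglongrightarrow> \<mu> \<tau> (?S \<inter> {..b})"
      if "\<tau> \<in> space (lebesgue_on {0..T})" for \<tau>
      using that by (intro lim) simp
  qed
  have e: "\<mu> \<tau> (?S \<inter> Pair \<tau> -` {..(a, b)}) = indicator {..a} \<tau> * \<mu> \<tau> (?S \<inter> {..b})"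
    if "\<tau> \<in> {0..T}" for \<tau>
  proof -
    have "Pair \<tau> -` {..(a, b)} = (if \<tau> \<le> a then {..b} else {})" by auto
    then show ?thesis
      using signed_measure_empty[OF signed_measures_leD(1)[OF m_mapsD(1)[OF \<mu> K that]]] by auto
  qed
  have i: "(indicator {..a} :: real \<Rightarrow> real) \<in> borel_measurable (lebesgue_on {0..T})"
    by (intro measurable_restrict_space1 borel_measurable_indicator) auto
  show ?thesis
    by (rule iffD2[OF measurable_cong borel_measurable_times[OF i m]], rule e) simp
qed

text \<open>
  Lower orthants form an intersection-stable generator of the Borel sets of the plane, and the sets \<open>A\<close>
  whose sections have measurable \<open>\<mu> \<tau>\<close>-values are closed under complements and disjoint countable unions
  because every \<open>\<mu> \<tau>\<close> is countably additive. This is what makes the integral defining the measure on the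
  rectangle meaningful for all Borel sets.
\<close>

lemma kernel_measurable:
  assumes \<mu>: "\<mu> \<in> m_maps T K" and K: "0 \<le> K" and A: "A \<in> sets borel"
  shows "(\<lambda>\<tau>. \<mu> \<tau> ({-1..0} \<inter> Pair \<tau> -` A)) \<in> borel_measurable (lebesgue_on {0..T})"
proof -
  let ?S = "{-1..0::real}" and ?G = "range (\<lambda>p :: real \<times> real. {..p})"
  let ?L = "lebesgue_on {0..T}"
  have borel: "sets borel = sigma_sets UNIV ?G"
    by (subst borel_eq_atMost) simp
  have sm: "\<mu> \<tau> \<in> signed_measures ?S" if "\<tau> \<in> {0..T}" for \<tau>
    by (rule signed_measures_leD[OF m_mapsD(1)[OF \<mu> K that]])
  have "{..p} \<inter> {..q} = {..(min (fst p) (fst q), min (snd p) (snd q))}" for p q :: "real \<times> real"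
    by (cases p; cases q) auto
  then have "Int_stable ?G" by (auto simp: Int_stable_def)
  moreover have "?G \<subseteq> Pow UNIV" by simp
  moreover have "A \<in> sigma_sets UNIV ?G" using A borel by simp
  ultimately show ?thesis
  proof (induction rule: sigma_sets_induct_disjoint)
    case (basic A)
    then show ?case using kernel_measurable_lower_orthant[OF \<mu> K] by auto
  next
    case empty
    have "(\<lambda>\<tau>. \<mu> \<tau> (?S \<inter> Pair \<tau> -` {})) \<in> borel_measurable ?L \<longleftrightarrow> (\<lambda>\<tau>. 0 :: real) \<in> borel_measurable ?L"
      by (rule measurable_cong) (simp add: signed_measure_empty[OF sm])
    then show ?case by simp
  next
    case (compl A)
    have all: "(\<lambda>\<tau>. signed_integral ?S (\<mu> \<tau>) (\<lambda>_. 1)) \<in> borel_measurable ?L"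
      by (intro m_mapsD(2)[OF \<mu>] continuous_intros)
    have "(\<lambda>\<tau>. \<mu> \<tau> (?S \<inter> Pair \<tau> -` (UNIV - A))) \<in> borel_measurable ?L \<longleftrightarrow>
      (\<lambda>\<tau>. signed_integral ?S (\<mu> \<tau>) (\<lambda>_. 1) - \<mu> \<tau> (?S \<inter> Pair \<tau> -` A)) \<in> borel_measurable ?L"
    proof (rule measurable_cong)
      fix \<tau> assume "\<tau> \<in> space ?L"
      then have \<tau>: "\<tau> \<in> {0..T}" by simp
      have top: "?S \<in> sets (borel_on ?S)" using sets.top[of "borel_on ?S"] by simp
      have "signed_integral ?S (\<mu> \<tau>) (\<lambda>_. 1) = signed_integral ?S (\<mu> \<tau>) (indicator ?S)"
        by (rule signed_integral_cong) simp
      also have "\<dots> = \<mu> \<tau> ?S" by (rule signed_integral_indicator[OF m_mapsD(1)[OF \<mu> K \<tau>] top])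
      finally have 1: "signed_integral ?S (\<mu> \<tau>) (\<lambda>_. 1) = \<mu> \<tau> ?S" .
      have "A \<in> sets borel" using compl borel by simp
      then have "\<mu> \<tau> (?S - (?S \<inter> Pair \<tau> -` A)) = \<mu> \<tau> ?S - \<mu> \<tau> (?S \<inter> Pair \<tau> -` A)"
        by (intro signed_measure_Diff[OF sm[OF \<tau>] top sets_section]) auto
      moreover have "?S \<inter> Pair \<tau> -` (UNIV - A) = ?S - (?S \<inter> Pair \<tau> -` A)" by auto
      ultimately show "\<mu> \<tau> (?S \<inter> Pair \<tau> -` (UNIV - A)) =
          signed_integral ?S (\<mu> \<tau>) (\<lambda>_. 1) - \<mu> \<tau> (?S \<inter> Pair \<tau> -` A)"
        unfolding 1 by simp
    qed
    then show ?case using all compl by simp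
  next
    case (union A)
    show ?case
    proof (rule borel_measurable_LIMSEQ_real)
      fix \<tau> assume "\<tau> \<in> space ?L"
      then have \<tau>: "\<tau> \<in> {0..T}" by simp
      have b: "A i \<in> sets borel" for i using union borel by auto
      have "(\<lambda>i. \<mu> \<tau> (?S \<inter> Pair \<tau> -` A i)) sums \<mu> \<tau> (\<Union>i. ?S \<inter> Pair \<tau> -` A i)"
        using union(1) sets_section[OF b]
        by (intro signed_measure_sums[OF sm[OF \<tau>]]) (auto simp: disjoint_family_on_def)
      also have "(\<Union>i. ?S \<inter> Pair \<tau> -` A i) = ?S \<inter> Pair \<tau> -` (\<Union>i. A i)" by auto
      finally show "(\<lambda>n. \<Sum>i<n. \<mu> \<tau> (?S \<inter> Pair \<tau> -` A i)) \<longlonglongrightarrow> \<mu> \<tau> (?S \<inter> Pair \<tau> -` (\<Union>i. A i))"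
        by (simp add: sums_def)
    next
      show "(\<lambda>\<tau>. \<Sum>i<n. \<mu> \<tau> (?S \<inter> Pair \<tau> -` A i)) \<in> borel_measurable ?L" for n
        by (intro borel_measurable_sum union)
    qed
  qed
qed

section \<open>The integrated measure and its integrals\<close>

lemma finite_measure_lebesgue_on_interval: "finite_measure (lebesgue_on {a..b::real})"
  by (intro finite_measure_lebesgue_on) auto

lemma integrable_lebesgue_on_bounded:
  fixes f :: "real \<Rightarrow> real"
  assumes "f \<in> borel_measurable (lebesgue_on {a..b})" "\<And>x. x \<in> {a..b} \<Longrightarrow> \<bar>f x\<bar> \<le> C"
  shows "integrable (lebesgue_on {a..b}) f"
proof -
  interpret finite_measure "lebesgue_on {a..b}" by (rule finite_measure_lebesgue_on_interval)
  show ?thesis by (rule integrable_const_bound[where B = C]) (use assms in auto)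
qed

lemma nu_eq:
  assumes "A \<in> sets (borel_on (Q_rect T))"
  shows "nu T \<mu> A = (LINT \<tau>|lebesgue_on {0..T}. \<mu> \<tau> ({-1..0} \<inter> Pair \<tau> -` A))"
    and "A \<in> sets borel" and "A \<subseteq> Q_rect T"
proof -
  have Q: "Q_rect T \<in> sets borel" 
    unfolding Q_rect_def by (intro borel_closed closed_Times) auto
  from assms show AQ: "A \<in> sets borel" "A \<subseteq> Q_rect T"
    using Q sets_restrict_space_iff[of "Q_rect T" borel A] by auto
  have "{s. (\<tau>, s) \<in> A} = {-1..0} \<inter> Pair \<tau> -` A" for \<tau>
    using AQ(2) by (auto simp: Q_rect_def)
  then show "nu T \<mu> A = (LINT \<tau>|lebesgue_on {0..T}. \<mu> \<tau> ({-1..0} \<inter> Pair \<tau> -` A))"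
    using assms by (simp add: nu_def)
qed

text \<open>
  Countable additivity of the kernels passes through the integral over \<open>\<tau>\<close> by dominated convergence: a partial
  sum is the value of a kernel on a finite union, hence bounded by \<open>K\<close> no matter how many terms it has.
\<close>

lemma nu_signed_measures_le:
  assumes \<mu>: "\<mu> \<in> m_maps T K" and K: "0 \<le> K" and T: "0 \<le> T"
  shows "nu T \<mu> \<in> signed_measures_le (Q_rect T) (K * T)"
proof -
  let ?S = "{-1..0::real}" and ?L = "lebesgue_on {0..T}"
  note \<mu>\<tau> = m_mapsD(1)[OF \<mu> K]
  note sm = signed_measures_leD(1)[OF \<mu>\<tau>]
  have bnd: "\<bar>\<mu> \<tau> (?S \<inter> Pair \<tau> -` A)\<bar> \<le> K" if "\<tau> \<in> {0..T}" "A \<in> sets borel" for \<tau> A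
    by (rule signed_measures_leD(2)[OF \<mu>\<tau>[OF that(1)] sets_section[OF that(2)]])
  have int: "integrable ?L (\<lambda>\<tau>. \<mu> \<tau> (?S \<inter> Pair \<tau> -` A))" if "A \<in> sets borel" for A
    by (intro integrable_lebesgue_on_bounded[where C = K] kernel_measurable[OF \<mu> K] bnd that)
  have empty: "nu T \<mu> {} = 0"
  proof -
    have "nu T \<mu> {} = (LINT \<tau>|?L. \<mu> \<tau> (?S \<inter> Pair \<tau> -` {}))" by (rule nu_eq) simp
    also have "\<dots> = (LINT \<tau>|?L. 0)"
      by (rule Bochner_Integration.integral_cong) (simp_all add: signed_measure_empty[OF sm])
    finally show ?thesis by simp
  qed
  have "(\<lambda>n. nu T \<mu> (A n)) sums nu T \<mu> (\<Union>n. A n)"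
    if A: "range A \<subseteq> sets (borel_on (Q_rect T))" "disjoint_family A" for A :: "nat \<Rightarrow> _"
  proof -
    have AQ: "A i \<in> sets (borel_on (Q_rect T))" for i using A by auto
    note Ab = nu_eq(2)[OF AQ]
    have UQ: "(\<Union>i. A i) \<in> sets (borel_on (Q_rect T))" using AQ by auto
    have dis: "disjoint_family (\<lambda>i. ?S \<inter> Pair \<tau> -` A i)" for \<tau>
      using A(2) by (auto simp: disjoint_family_on_def)
    have vU: "(\<Union>i\<in>I. ?S \<inter> Pair \<tau> -` A i) = ?S \<inter> Pair \<tau> -` (\<Union>i\<in>I. A i)" for I \<tau> by auto
    have part: "(\<Sum>i<n. \<mu> \<tau> (?S \<inter> Pair \<tau> -` A i)) = \<mu> \<tau> (?S \<inter> Pair \<tau> -` (\<Union>i<n. A i))"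
      if "\<tau> \<in> {0..T}" for \<tau> n
      using signed_measure_sum_lessThan[OF sm[OF that] sets_section[OF Ab] dis] by (simp only: vU)
    have "(\<lambda>n. LINT \<tau>|?L. (\<Sum>i<n. \<mu> \<tau> (?S \<inter> Pair \<tau> -` A i)))
        \<longlonglongrightarrow> (LINT \<tau>|?L. \<mu> \<tau> (?S \<inter> Pair \<tau> -` (\<Union>i. A i)))"
    proof (rule integral_dominated_convergence[where w = "\<lambda>_. K"])
      show "(\<lambda>\<tau>. \<mu> \<tau> (?S \<inter> Pair \<tau> -` (\<Union>i. A i))) \<in> borel_measurable ?L"
        by (intro kernel_measurable[OF \<mu> K]) (use Ab in auto)
      show "(\<lambda>\<tau>. \<Sum>i<n. \<mu> \<tau> (?S \<inter> Pair \<tau> -` A i)) \<in> borel_measurable ?L" for n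
        by (intro borel_measurable_sum kernel_measurable[OF \<mu> K] Ab)
      show "integrable ?L (\<lambda>_. K)" 
        by (rule integrable_lebesgue_on_bounded[where C = "\<bar>K\<bar>"]) auto
      have "(\<lambda>n. \<Sum>i<n. \<mu> \<tau> (?S \<inter> Pair \<tau> -` A i)) \<longlonglongrightarrow> \<mu> \<tau> (?S \<inter> Pair \<tau> -` (\<Union>i. A i))"
        if "\<tau> \<in> {0..T}" for \<tau>
        using signed_measure_sums[OF sm[OF that] _ dis] sets_section[OF Ab]
        unfolding vU sums_def by blast
      then show "AE \<tau> in ?L. (\<lambda>n. \<Sum>i<n. \<mu> \<tau> (?S \<inter> Pair \<tau> -` A i)) \<longlonglongrightarrow> \<mu> \<tau> (?S \<inter> Pair \<tau> -` (\<Union>i. A i))"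
        by (intro AE_I2) simp
      have "\<bar>\<Sum>i<n. \<mu> \<tau> (?S \<inter> Pair \<tau> -` A i)\<bar> \<le> K" if "\<tau> \<in> {0..T}" for \<tau> n
        unfolding part[OF that] by (rule bnd[OF that]) (use Ab in auto)
      then show "AE \<tau> in ?L. norm (\<Sum>i<n. \<mu> \<tau> (?S \<inter> Pair \<tau> -` A i)) \<le> K" for n
        by (intro AE_I2) simp
    qed
    moreover have "(LINT \<tau>|?L. (\<Sum>i<n. \<mu> \<tau> (?S \<inter> Pair \<tau> -` A i))) = (\<Sum>i<n. nu T \<mu> (A i))" for n
      by (subst Bochner_Integration.integral_sum) (simp_all add: int Ab nu_eq(1)[OF AQ])
    ultimately show ?thesis by (simp add: sums_def nu_eq(1)[OF UQ])
  qed
  moreover have "\<bar>nu T \<mu> A\<bar> \<le> K * T" if A: "A \<in> sets (borel_on (Q_rect T))" for A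
  proof -
    have "\<bar>LINT \<tau>|?L. \<mu> \<tau> (?S \<inter> Pair \<tau> -` A)\<bar> \<le> K * measure ?L (space ?L)"
      using kernel_measurable[OF \<mu> K nu_eq(2)[OF A]] bnd[OF _ nu_eq(2)[OF A]]
      by (intro integral_abs_bound_const finite_measure_lebesgue_on_interval) auto
    then show ?thesis using T by (simp add: nu_eq(1)[OF A] measure_restrict_space)
  qed
  ultimately show ?thesis
    using empty by (auto simp: signed_measures_le_def signed_measures_def nu_def)
qed

text \<open>
  For indicators this is the definition of the integrated measure; linearity and bounded monotone limits do the
  rest. The Jordan parts of the integrated measure are never compared with those of the kernels:
  only the two signed integrals are, and both are linear and satisfy dominated convergence.
  Boundedness is a premise inside the induction, so that it is inherited by the simpler functions.
\<close>

lemma nu_fubini_nonneg: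
  assumes \<mu>: "\<mu> \<in> m_maps T K" and K: "0 \<le> K" and T: "0 \<le> T"
    and f: "f \<in> borel_measurable borel" "\<And>p. 0 \<le> f p"
    and bdd: "\<exists>C. \<forall>p\<in>Q_rect T. \<bar>f p\<bar> \<le> C"
  shows "(\<lambda>\<tau>. signed_integral {-1..0} (\<mu> \<tau>) (\<lambda>s. f (\<tau>, s))) \<in> borel_measurable (lebesgue_on {0..T}) \<and>
    signed_integral (Q_rect T) (nu T \<mu>) f =
      (LINT \<tau>|lebesgue_on {0..T}. signed_integral {-1..0} (\<mu> \<tau>) (\<lambda>s. f (\<tau>, s)))"
proof -
  let ?S = "{-1..0::real}" and ?L = "lebesgue_on {0..T}" and ?Q = "Q_rect T"
  let ?I = "\<lambda>f \<tau>. signed_integral ?S (\<mu> \<tau>) (\<lambda>s. f (\<tau>, s))"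
  note \<mu>\<tau> = m_mapsD(1)[OF \<mu> K] and \<nu> = nu_signed_measures_le[OF \<mu> K T]
  have Q: "?Q \<in> sets borel" unfolding Q_rect_def by (intro borel_closed closed_Times) auto
  have QI: "(\<tau>, s) \<in> ?Q" if "\<tau> \<in> {0..T}" "s \<in> ?S" for \<tau> s using that by (simp add: Q_rect_def)
  have bnd: "\<bar>?I u \<tau>\<bar> \<le> 2 * K * C"
    if "\<tau> \<in> {0..T}" "u \<in> borel_measurable borel" "\<forall>p\<in>?Q. \<bar>u p\<bar> \<le> C" for u :: "real \<times> real \<Rightarrow> real" and \<tau> C
  proof (rule signed_integral_bound[OF \<mu>\<tau>[OF that(1)] borel_measurable_section[OF that(2)]])
    show "\<bar>u (\<tau>, x)\<bar> \<le> C" if "x \<in> ?S" for x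
      using QI[OF \<open>\<tau> \<in> _\<close> that] \<open>\<forall>p\<in>?Q. _\<close> by auto
    show "0 \<le> C" using QI[OF \<open>\<tau> \<in> _\<close>, of 0] \<open>\<forall>p\<in>?Q. _\<close> by force
  qed
  from f bdd show ?thesis
  proof (induction rule: borel_measurable_induct_real)
    case (set A)
    have AQ: "?Q \<inter> A \<in> sets (borel_on ?Q)" using set by (auto simp: sets_restrict_space)
    have e: "?I (indicator A) \<tau> = \<mu> \<tau> (?S \<inter> Pair \<tau> -` (?Q \<inter> A))" if \<tau>: "\<tau> \<in> {0..T}" for \<tau>
    proof -
      have "?I (indicator A) \<tau> = signed_integral ?S (\<mu> \<tau>) (indicator (?S \<inter> Pair \<tau> -` (?Q \<inter> A)))"
        by (rule signed_integral_cong) (use QI[OF \<tau>] in \<open>auto simp: indicator_def\<close>)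
      also have "\<dots> = \<mu> \<tau> (?S \<inter> Pair \<tau> -` (?Q \<inter> A))"
        by (intro signed_integral_indicator[OF \<mu>\<tau>[OF \<tau>]] sets_section) (use set Q in auto)
      finally show ?thesis .
    qed
    have "?I (indicator A) \<in> borel_measurable ?L \<longleftrightarrow>
        (\<lambda>\<tau>. \<mu> \<tau> (?S \<inter> Pair \<tau> -` (?Q \<inter> A))) \<in> borel_measurable ?L"
      by (rule measurable_cong) (simp add: e)
    then have "?I (indicator A) \<in> borel_measurable ?L"
      using kernel_measurable[OF \<mu> K, of "?Q \<inter> A"] set Q by auto
    moreover have "signed_integral ?Q (nu T \<mu>) (indicator A) = signed_integral ?Q (nu T \<mu>) (indicator (?Q \<inter> A))"
      by (rule signed_integral_cong) (auto simp: indicator_def)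
    moreover have "\<dots> = (LINT \<tau>|?L. \<mu> \<tau> (?S \<inter> Pair \<tau> -` (?Q \<inter> A)))"
      by (simp only: signed_integral_indicator[OF \<nu> AQ] nu_eq(1)[OF AQ])
    moreover have "\<dots> = (LINT \<tau>|?L. ?I (indicator A) \<tau>)"
      by (rule Bochner_Integration.integral_cong) (simp_all add: e)
    ultimately show ?case by simp
  next
    case (mult u c)
    show ?case
    proof (cases "c = 0")
      case True
      then show ?thesis by (simp add: signed_integral_def)
    next
      case False
      with mult(1) have c: "0 < c" by simp
      from mult.prems obtain C where C: "\<forall>p\<in>?Q. \<bar>c * u p\<bar> \<le> C" by blast
      have "\<forall>p\<in>?Q. \<bar>u p\<bar> \<le> C / c"
      proof
        fix p assume "p \<in> ?Q"
        with C have "\<bar>c * u p\<bar> \<le> C" by blast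
        with c show "\<bar>u p\<bar> \<le> C / c" by (simp add: abs_mult pos_le_divide_eq mult.commute)
      qed
      then show ?thesis using mult(4) by (auto simp: signed_integral_cmult intro!: borel_measurable_times)
    qed
  next
    case (add u v)
    from add.prems obtain C where C: "\<And>p. p \<in> ?Q \<Longrightarrow> \<bar>v p + u p\<bar> \<le> C" by auto
    have Cu: "\<forall>p\<in>?Q. \<bar>u p\<bar> \<le> C" and Cv: "\<forall>p\<in>?Q. \<bar>v p\<bar> \<le> C"
      using C add.hyps(2,4) by (smt (verit))+
    have IHu: "?I u \<in> borel_measurable ?L" "signed_integral ?Q (nu T \<mu>) u = integral\<^sup>L ?L (?I u)"
      and IHv: "?I v \<in> borel_measurable ?L" "signed_integral ?Q (nu T \<mu>) v = integral\<^sup>L ?L (?I v)"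
      using add.IH Cu Cv by blast+
    have e: "?I (\<lambda>p. v p + u p) \<tau> = ?I v \<tau> + ?I u \<tau>" if \<tau>: "\<tau> \<in> {0..T}" for \<tau>
      by (rule signed_integral_add[OF \<mu>\<tau>[OF \<tau>], where C = C and D = C])
        (use Cu Cv QI[OF \<tau>] in \<open>auto intro: borel_measurable_section[OF add.hyps(1)] borel_measurable_section[OF add.hyps(3)]\<close>)
    have "?I (\<lambda>p. v p + u p) \<in> borel_measurable ?L \<longleftrightarrow> (\<lambda>\<tau>. ?I v \<tau> + ?I u \<tau>) \<in> borel_measurable ?L"
      by (rule measurable_cong) (simp add: e)
    then have "?I (\<lambda>p. v p + u p) \<in> borel_measurable ?L"
      using borel_measurable_add[OF IHv(1) IHu(1)] by simp
    moreover have "signed_integral ?Q (nu T \<mu>) (\<lambda>p. v p + u p)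
        = signed_integral ?Q (nu T \<mu>) v + signed_integral ?Q (nu T \<mu>) u"
      by (rule signed_integral_add[OF \<nu>, where C = C and D = C])
        (use Cu Cv in \<open>auto intro!: measurable_restrict_space1 add.hyps(1,3)\<close>)
    moreover have "\<dots> = (LINT \<tau>|?L. ?I v \<tau> + ?I u \<tau>)"
      unfolding IHu(2) IHv(2)
      by (intro Bochner_Integration.integral_add[symmetric]
          integrable_lebesgue_on_bounded[where C = "2 * K * C"] IHu IHv bnd[OF _ add.hyps(1) Cu] bnd[OF _ add.hyps(3) Cv])
    moreover have "\<dots> = (LINT \<tau>|?L. ?I (\<lambda>p. v p + u p) \<tau>)"
      by (rule Bochner_Integration.integral_cong) (simp_all add: e)
    ultimately show ?case by simp
  next
    case (seq U)
    from seq.prems obtain C where C: "\<And>p. p \<in> ?Q \<Longrightarrow> \<bar>f p\<bar> \<le> C" by auto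
    have le: "U i p \<le> f p" for i p
    proof (rule incseq_le)
      show "incseq (\<lambda>i. U i p)" using seq.hyps(3) by (metis incseq_def le_funD)
      show "(\<lambda>i. U i p) \<longlonglongrightarrow> f p" using seq.hyps by simp
    qed
    have CU: "\<forall>p\<in>?Q. \<bar>U i p\<bar> \<le> C" for i
      using C le[of i] seq.hyps(2)[of i] by (smt (verit))
    have IH: "?I (U i) \<in> borel_measurable ?L" "signed_integral ?Q (nu T \<mu>) (U i) = integral\<^sup>L ?L (?I (U i))" for i
      using seq.IH CU by blast+
    have lim: "(\<lambda>i. ?I (U i) \<tau>) \<longlonglongrightarrow> ?I f \<tau>" if \<tau>: "\<tau> \<in> {0..T}" for \<tau>
      by (rule signed_integral_tendsto[OF \<mu>\<tau>[OF \<tau>], where C = C])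
        (use CU QI[OF \<tau>] seq.hyps in \<open>auto intro: borel_measurable_section[OF seq.hyps(1)]\<close>)
    have m: "?I f \<in> borel_measurable ?L"
      by (rule borel_measurable_LIMSEQ_real[where u = "\<lambda>i. ?I (U i)", OF _ IH(1)]) (simp add: lim)
    have "(\<lambda>i. LINT \<tau>|?L. ?I (U i) \<tau>) \<longlonglongrightarrow> (LINT \<tau>|?L. ?I f \<tau>)"
    proof (rule integral_dominated_convergence[where w = "\<lambda>_. 2 * K * C"])
      show "integrable ?L (\<lambda>_. 2 * K * C)" 
        by (rule integrable_lebesgue_on_bounded[where C = "\<bar>2 * K * C\<bar>"]) auto
      show "AE \<tau> in ?L. (\<lambda>i. ?I (U i) \<tau>) \<longlonglongrightarrow> ?I f \<tau>" by (intro AE_I2) (simp add: lim)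
      show "AE \<tau> in ?L. norm (?I (U i) \<tau>) \<le> 2 * K * C" for i
        by (intro AE_I2) (simp add: bnd[OF _ seq.hyps(1) CU])
    qed (use m IH in auto)
    moreover have "(\<lambda>i. signed_integral ?Q (nu T \<mu>) (U i)) \<longlonglongrightarrow> signed_integral ?Q (nu T \<mu>) f"
      by (rule signed_integral_tendsto[OF \<nu>, where C = C])
        (use CU seq.hyps in \<open>auto intro!: measurable_restrict_space1\<close>)
    ultimately show ?case
      using m LIMSEQ_unique unfolding IH(2) by blast
  qed
qed

lemma nu_fubini:
  assumes \<mu>: "\<mu> \<in> m_maps T K" and K: "0 \<le> K" and T: "0 \<le> T"
    and f: "f \<in> borel_measurable borel" and bdd: "\<And>p. p \<in> Q_rect T \<Longrightarrow> \<bar>f p\<bar> \<le> C"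
  shows "(\<lambda>\<tau>. signed_integral {-1..0} (\<mu> \<tau>) (\<lambda>s. f (\<tau>, s))) \<in> borel_measurable (lebesgue_on {0..T})"
    and "signed_integral (Q_rect T) (nu T \<mu>) f =
      (LINT \<tau>|lebesgue_on {0..T}. signed_integral {-1..0} (\<mu> \<tau>) (\<lambda>s. f (\<tau>, s)))"
    and "\<And>\<tau>. \<tau> \<in> {0..T} \<Longrightarrow> \<bar>signed_integral {-1..0} (\<mu> \<tau>) (\<lambda>s. f (\<tau>, s))\<bar> \<le> 2 * K * C"
proof -
  let ?S = "{-1..0::real}" and ?L = "lebesgue_on {0..T}" and ?Q = "Q_rect T"
  let ?I = "\<lambda>f \<tau>. signed_integral ?S (\<mu> \<tau>) (\<lambda>s. f (\<tau>, s))"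
  let ?p = "\<lambda>p. max 0 (f p)" and ?n = "\<lambda>p. max 0 (- f p)"
  note \<mu>\<tau> = m_mapsD(1)[OF \<mu> K] and \<nu> = nu_signed_measures_le[OF \<mu> K T]
  have QI: "(\<tau>, s) \<in> ?Q" if "\<tau> \<in> {0..T}" "s \<in> ?S" for \<tau> s using that by (simp add: Q_rect_def)
  have C: "0 \<le> C" using bdd[of "(0, 0)"] T by (simp add: Q_rect_def)
  have bnd: "\<bar>?I u \<tau>\<bar> \<le> 2 * K * C"
    if "\<tau> \<in> {0..T}" "u \<in> borel_measurable borel" "\<And>p. p\<in>?Q \<Longrightarrow> \<bar>u p\<bar> \<le> C" for u :: "real \<times> real \<Rightarrow> real" and \<tau>
    using QI[OF that(1)] that(3)
    by (intro signed_integral_bound[OF \<mu>\<tau>[OF that(1)] borel_measurable_section[OF that(2)]] C) auto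
  show "\<And>\<tau>. \<tau> \<in> {0..T} \<Longrightarrow> \<bar>?I f \<tau>\<bar> \<le> 2 * K * C" by (rule bnd[OF _ f bdd])
  have m: "?p \<in> borel_measurable borel" "?n \<in> borel_measurable borel" using f by auto
  have b: "\<bar>?p p\<bar> \<le> C" "\<bar>?n p\<bar> \<le> C" if "p \<in> ?Q" for p using bdd[OF that] by auto
  have P: "?I ?p \<in> borel_measurable ?L" "signed_integral ?Q (nu T \<mu>) ?p = integral\<^sup>L ?L (?I ?p)"
    using nu_fubini_nonneg[OF \<mu> K T m(1)] b(1) max.cobounded1 by blast+
  have N: "?I ?n \<in> borel_measurable ?L" "signed_integral ?Q (nu T \<mu>) ?n = integral\<^sup>L ?L (?I ?n)"
    using nu_fubini_nonneg[OF \<mu> K T m(2)] b(2) max.cobounded1 by blast+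
  have d: "f = (\<lambda>p. ?p p - ?n p)" by auto
  have e: "?I f \<tau> = ?I ?p \<tau> - ?I ?n \<tau>" if \<tau>: "\<tau> \<in> {0..T}" for \<tau>
    by (subst d, rule signed_integral_diff[OF \<mu>\<tau>[OF \<tau>] borel_measurable_section[OF m(1)] _ borel_measurable_section[OF m(2)]])
      (use QI[OF \<tau>] b in blast)+
  have "?I f \<in> borel_measurable ?L \<longleftrightarrow> (\<lambda>\<tau>. ?I ?p \<tau> - ?I ?n \<tau>) \<in> borel_measurable ?L"
    by (rule measurable_cong) (simp add: e)
  then show "?I f \<in> borel_measurable ?L" using borel_measurable_diff[OF P(1) N(1)] by simp
  have "signed_integral ?Q (nu T \<mu>) f = signed_integral ?Q (nu T \<mu>) ?p - signed_integral ?Q (nu T \<mu>) ?n"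
    by (subst d, rule signed_integral_diff[OF \<nu> measurable_restrict_space1[OF m(1)] b(1) measurable_restrict_space1[OF m(2)] b(2)])
  also have "\<dots> = (LINT \<tau>|?L. ?I ?p \<tau> - ?I ?n \<tau>)"
    unfolding P(2) N(2)
    by (intro Bochner_Integration.integral_diff[symmetric]
        integrable_lebesgue_on_bounded[where C = "2 * K * C"] P N bnd m b)
  also have "\<dots> = (LINT \<tau>|?L. ?I f \<tau>)"
    by (rule Bochner_Integration.integral_cong) (simp_all add: e)
  finally show "signed_integral ?Q (nu T \<mu>) f = (LINT \<tau>|?L. ?I f \<tau>)" .
qed

text \<open>
  The integrals only see the values on the rectangle, so a continuous function on it can be replaced by its
  extension by zero, which is Borel on the whole plane.
\<close>

lemma continuous_on_Q_extension:
  fixes z :: "real \<times> real \<Rightarrow> real"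
  assumes "continuous_on (Q_rect T) z"
  obtains f C where "f \<in> borel_measurable borel" "\<And>p. p \<in> Q_rect T \<Longrightarrow> f p = z p"
    "\<And>p. p \<in> Q_rect T \<Longrightarrow> \<bar>f p\<bar> \<le> C"
proof -
  have "compact (Q_rect T)" unfolding Q_rect_def by (intro compact_Times) auto
  then have "bounded (z ` Q_rect T)" using assms by (intro compact_imp_bounded compact_continuous_image)
  then obtain C where "\<And>p. p \<in> Q_rect T \<Longrightarrow> \<bar>z p\<bar> \<le> C" by (auto simp: bounded_iff)
  moreover have "(\<lambda>p. indicator (Q_rect T) p *\<^sub>R z p) \<in> borel_measurable borel"
    using assms by (intro borel_measurable_continuous_on_indicator)
      (auto simp: Q_rect_def intro!: borel_closed closed_Times)
  ultimately show thesis by (intro that[of "\<lambda>p. indicator (Q_rect T) p *\<^sub>R z p" C]) auto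
qed

lemma nu_fubini_continuous:
  assumes \<mu>: "\<mu> \<in> m_maps T K" and K: "0 \<le> K" and T: "0 \<le> T"
    and z: "continuous_on (Q_rect T) z"
  shows "signed_integral (Q_rect T) (nu T \<mu>) z =
      (LINT \<tau>|lebesgue_on {0..T}. signed_integral {-1..0} (\<mu> \<tau>) (\<lambda>s. z (\<tau>, s)))"
    and "(\<lambda>\<tau>. signed_integral {-1..0} (\<mu> \<tau>) (\<lambda>s. z (\<tau>, s))) \<in> borel_measurable (lebesgue_on {0..T})"
    and "\<exists>B. \<forall>\<tau>\<in>{0..T}. \<bar>signed_integral {-1..0} (\<mu> \<tau>) (\<lambda>s. z (\<tau>, s))\<bar> \<le> B"
proof -
  let ?S = "{-1..0::real}" and ?L = "lebesgue_on {0..T}" and ?Q = "Q_rect T"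
  obtain f C where f: "f \<in> borel_measurable borel" "\<And>p. p \<in> ?Q \<Longrightarrow> f p = z p"
    "\<And>p. p \<in> ?Q \<Longrightarrow> \<bar>f p\<bar> \<le> C"
    using continuous_on_Q_extension[OF z] by blast
  have F: "(\<lambda>\<tau>. signed_integral ?S (\<mu> \<tau>) (\<lambda>s. f (\<tau>, s))) \<in> borel_measurable ?L"
    "signed_integral ?Q (nu T \<mu>) f = (LINT \<tau>|?L. signed_integral ?S (\<mu> \<tau>) (\<lambda>s. f (\<tau>, s)))"
    "\<tau> \<in> {0..T} \<Longrightarrow> \<bar>signed_integral ?S (\<mu> \<tau>) (\<lambda>s. f (\<tau>, s))\<bar> \<le> 2 * K * C" for \<tau>
    using f(3) by (blast intro: nu_fubini[OF \<mu> K T f(1)])+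
  have e: "signed_integral ?S (\<mu> \<tau>) (\<lambda>s. f (\<tau>, s)) = signed_integral ?S (\<mu> \<tau>) (\<lambda>s. z (\<tau>, s))"
    if "\<tau> \<in> {0..T}" for \<tau>
    using that by (intro signed_integral_cong f(2)) (simp add: Q_rect_def)
  have "signed_integral ?Q (nu T \<mu>) z = signed_integral ?Q (nu T \<mu>) f"
    by (intro signed_integral_cong f(2)[symmetric])
  also have "\<dots> = (LINT \<tau>|?L. signed_integral ?S (\<mu> \<tau>) (\<lambda>s. z (\<tau>, s)))"
    by (subst F(2), rule Bochner_Integration.integral_cong) (simp_all add: e)
  finally show "signed_integral ?Q (nu T \<mu>) z = (LINT \<tau>|?L. signed_integral ?S (\<mu> \<tau>) (\<lambda>s. z (\<tau>, s)))" .
  show "(\<lambda>\<tau>. signed_integral ?S (\<mu> \<tau>) (\<lambda>s. z (\<tau>, s))) \<in> borel_measurable ?L"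
    using F(1) measurable_cong[of ?L, OF e] by simp
  show "\<exists>B. \<forall>\<tau>\<in>{0..T}. \<bar>signed_integral ?S (\<mu> \<tau>) (\<lambda>s. z (\<tau>, s))\<bar> \<le> B"
    using F(3) e by metis
qed

section \<open>Polynomials adapted to the shift\<close>

text \<open>
  The functions \<open>\<tau>\<^sup>i (\<tau> + s)\<^sup>j\<close>. Their span contains both coordinates and is closed under products, so it consists of
  all polynomials in two variables. Unlike the usual monomials, each of them is a weight in \<open>\<tau>\<close> times a
  function of \<open>\<tau> + s\<close>, which is the kind of integrand that condition (i) speaks about.
\<close>

definition shift_monomial :: "nat \<times> nat \<Rightarrow> real \<times> real \<Rightarrow> real"
  where "shift_monomial k p = fst p ^ fst k * (fst p + snd p) ^ snd k"

text \<open>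
  The linear span, given by rules so that statements about it follow by induction without a
  choice of coefficients.
\<close>

inductive shift_polynomial :: "(real \<times> real \<Rightarrow> real) \<Rightarrow> bool" where
  monomial: "shift_polynomial (shift_monomial k)"
| add: "shift_polynomial u \<Longrightarrow> shift_polynomial v \<Longrightarrow> shift_polynomial (\<lambda>p. u p + v p)"
| scale: "shift_polynomial u \<Longrightarrow> shift_polynomial (\<lambda>p. c * u p)"

lemma continuous_on_shift_monomial [continuous_intros]: "continuous_on A (shift_monomial k)"
  unfolding shift_monomial_def[abs_def] by (intro continuous_intros)

lemma continuous_on_shift_polynomial: "shift_polynomial u \<Longrightarrow> continuous_on A u"
  by (induction rule: shift_polynomial.induct) (auto intro!: continuous_intros)

lemma shift_polynomial_mult:
  assumes "shift_polynomial u" "shift_polynomial v"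
  shows "shift_polynomial (\<lambda>p. u p * v p)"
  using assms(1)
proof induction
  case (monomial k)
  show ?case
    using assms(2)
  proof induction
    case (monomial l)
    have "(\<lambda>p. shift_monomial k p * shift_monomial l p) = shift_monomial (fst k + fst l, snd k + snd l)"
      by (auto simp: shift_monomial_def power_add)
    then show ?case by (simp add: shift_polynomial.monomial)
  next
    case (add u v)
    show ?case unfolding distrib_left by (rule shift_polynomial.add[OF add.IH])
  next
    case (scale u c)
    show ?case unfolding mult.left_commute[of _ c] by (rule shift_polynomial.scale[OF scale.IH])
  qed
next
  case (add u v)
  show ?case unfolding distrib_right by (rule shift_polynomial.add[OF add.IH])
next
  case (scale u c)
  show ?case unfolding mult.assoc by (rule shift_polynomial.scale[OF scale.IH])
qed

lemma real_polynomial_function_imp_shift_polynomial: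
  fixes p :: "real \<times> real \<Rightarrow> real"
  assumes "real_polynomial_function p"
  shows "shift_polynomial p"
  using assms
proof induction
  case (linear f)
  interpret bounded_linear f by fact
  have "f q = (f (1, 0) - f (0, 1)) * shift_monomial (1, 0) q + f (0, 1) * shift_monomial (0, 1) q" for q
  proof -
    obtain \<tau> s where q: "q = (\<tau>, s)" by fastforce
    have "f q = f (\<tau> *\<^sub>R (1, 0) + s *\<^sub>R (0, 1))" by (simp add: q)
    also have "\<dots> = \<tau> * f (1, 0) + s * f (0, 1)" by (simp only: add scaleR) simp
    finally show ?thesis by (simp add: q shift_monomial_def algebra_simps)
  qed
  then have eq: "f = (\<lambda>q. (f (1, 0) - f (0, 1)) * shift_monomial (1, 0) q + f (0, 1) * shift_monomial (0, 1) q)"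
    by (rule ext)
  show ?case
    by (rule ssubst[OF eq, of shift_polynomial]) (intro shift_polynomial.intros)
next
  case (const c)
  have "shift_polynomial (\<lambda>p. c * shift_monomial (0, 0) p)" by (intro shift_polynomial.intros)
  then show ?case by (simp add: shift_monomial_def)
qed (auto intro: shift_polynomial.add shift_polynomial_mult)

section \<open>The weak-* topology on bounded sets of measures\<close>

text \<open>
  On a bounded set of measures the weak-* topology is the one pulled back along the countable family of
  moments, from a space of sequences with the product topology.
\<close>

definition moments :: "real \<Rightarrow> (((real \<times> real) set) \<Rightarrow> real) \<Rightarrow> nat \<times> nat \<Rightarrow> real"
  where "moments T \<nu> k = signed_integral (Q_rect T) \<nu> (shift_monomial k)"

lemma continuous_on_Q_rectD:
  fixes z :: "real \<times> real \<Rightarrow> real"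
  assumes "continuous_on (Q_rect T) z"
  shows "z \<in> borel_measurable (borel_on (Q_rect T))" "\<exists>C. \<forall>p\<in>Q_rect T. \<bar>z p\<bar> \<le> C"
proof -
  show "z \<in> borel_measurable (borel_on (Q_rect T))"
    using assms by (rule borel_measurable_continuous_on_restrict)
  show "\<exists>C. \<forall>p\<in>Q_rect T. \<bar>z p\<bar> \<le> C"
    using continuous_on_Q_extension[OF assms] by metis
qed

text \<open>
  The integral of a polynomial is a finite linear combination of moments; all that matters later is that it depends on
  the sequence of moments through one continuous function, valid for every bounded measure.
\<close>

lemma shift_polynomial_moments:
  assumes "shift_polynomial u"
  shows "\<exists>L. continuous_on UNIV L \<and>
    (\<forall>R. \<forall>\<nu>\<in>signed_measures_le (Q_rect T) R. signed_integral (Q_rect T) \<nu> u = L (moments T \<nu>))"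
  using assms
proof induction
  case (monomial k)
  show ?case
    by (rule exI[of _ "\<lambda>w. w k"]) (simp add: moments_def continuous_on_product_coordinates)
next
  case (add u v)
  then obtain Lu Lv where L: "continuous_on UNIV Lu" "continuous_on UNIV Lv"
    "\<And>R \<nu>. \<nu> \<in> signed_measures_le (Q_rect T) R \<Longrightarrow> signed_integral (Q_rect T) \<nu> u = Lu (moments T \<nu>)"
    "\<And>R \<nu>. \<nu> \<in> signed_measures_le (Q_rect T) R \<Longrightarrow> signed_integral (Q_rect T) \<nu> v = Lv (moments T \<nu>)"
    by blast
  obtain C where C: "\<And>p. p \<in> Q_rect T \<Longrightarrow> \<bar>u p\<bar> \<le> C"
    using continuous_on_Q_rectD(2)[OF continuous_on_shift_polynomial[OF add.hyps(1)]] by blast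
  obtain D where D: "\<And>p. p \<in> Q_rect T \<Longrightarrow> \<bar>v p\<bar> \<le> D"
    using continuous_on_Q_rectD(2)[OF continuous_on_shift_polynomial[OF add.hyps(2)]] by blast
  have "signed_integral (Q_rect T) \<nu> (\<lambda>p. u p + v p) = Lu (moments T \<nu>) + Lv (moments T \<nu>)"
    if "\<nu> \<in> signed_measures_le (Q_rect T) R" for \<nu> R
  proof -
    have "signed_integral (Q_rect T) \<nu> (\<lambda>p. u p + v p) =
        signed_integral (Q_rect T) \<nu> u + signed_integral (Q_rect T) \<nu> v"
      by (rule signed_integral_add[OF that _ C _ D])
        (rule continuous_on_Q_rectD(1) continuous_on_shift_polynomial add.hyps | assumption)+
    then show ?thesis unfolding L(3)[OF that] L(4)[OF that] .
  qed
  moreover have "continuous_on UNIV (\<lambda>w. Lu w + Lv w)" by (rule continuous_on_add[OF L(1,2)])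
  ultimately show ?case by (intro exI[of _ "\<lambda>w. Lu w + Lv w"] conjI allI ballI) simp_all
next
  case (scale u c)
  then obtain L where L: "continuous_on UNIV L"
    "\<And>R \<nu>. \<nu> \<in> signed_measures_le (Q_rect T) R \<Longrightarrow> signed_integral (Q_rect T) \<nu> u = L (moments T \<nu>)"
    by blast
  have "continuous_on UNIV (\<lambda>w. c * L w)" by (rule continuous_on_mult[OF continuous_on_const L(1)])
  moreover have "signed_integral (Q_rect T) \<nu> (\<lambda>p. c * u p) = c * L (moments T \<nu>)"
    if "\<nu> \<in> signed_measures_le (Q_rect T) R" for \<nu> R
    using L(2)[OF that] by (simp add: signed_integral_cmult)
  ultimately show ?case by (intro exI[of _ "\<lambda>w. c * L w"] conjI allI ballI) simp_all
qed

text \<open>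
  By Stone-Weierstrass \<open>z\<close> is uniformly close to a polynomial \<open>g\<close>, and on measures with values
  bounded by \<open>R\<close> the integrals of \<open>z\<close> and \<open>g\<close> then differ by little, uniformly in the measure. So if the integral of \<open>z\<close> lies in
  \<open>U\<close>, this is forced by an open condition on the moments. The witness is the union of all
  open sets of sequences that force it.
\<close>

lemma weak_star_subbasic_moments:
  fixes U :: "real set"
  assumes z: "continuous_on (Q_rect T) z" and U: "open U" and R: "0 \<le> R"
  shows "\<exists>W. open W \<and>
    (\<forall>\<nu>\<in>signed_measures_le (Q_rect T) R. signed_integral (Q_rect T) \<nu> z \<in> U \<longleftrightarrow> moments T \<nu> \<in> W)"
proof -
  let ?Q = "Q_rect T" and ?B = "signed_measures_le (Q_rect T) R"
  let ?\<W> = "{W. open W \<and> (\<forall>\<nu>\<in>?B. moments T \<nu> \<in> W \<longrightarrow> signed_integral ?Q \<nu> z \<in> U)}"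
  have cover: "\<exists>W\<in>?\<W>. moments T \<nu> \<in> W" if \<nu>: "\<nu> \<in> ?B" and zU: "signed_integral ?Q \<nu> z \<in> U" for \<nu>
  proof -
    obtain \<epsilon> where \<epsilon>: "\<epsilon> > 0" "\<And>r. \<bar>r - signed_integral ?Q \<nu> z\<bar> < \<epsilon> \<Longrightarrow> r \<in> U"
      using U zU unfolding open_dist dist_real_def by blast
    \<comment> \<open>Chosen so that the error \<open>2 * R * \<delta>\<close> is at most \<open>\<epsilon> / 3\<close>, also when \<open>R = 0\<close>.\<close>
    define \<delta> where "\<delta> = \<epsilon> / (6 * R + 1)"
    have \<delta>: "\<delta> > 0" using \<epsilon>(1) R by (auto simp: \<delta>_def)
    have "compact ?Q" unfolding Q_rect_def by (intro compact_Times) auto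
    then obtain g where g: "real_polynomial_function g" "\<And>p. p \<in> ?Q \<Longrightarrow> \<bar>z p - g p\<bar> < \<delta>"
      using Stone_Weierstrass_real_polynomial_function[OF _ z \<delta>] by blast
    have gp: "shift_polynomial g" using g(1) by (rule real_polynomial_function_imp_shift_polynomial)
    note gc = continuous_on_shift_polynomial[OF gp]
    obtain C D where C: "\<And>p. p \<in> ?Q \<Longrightarrow> \<bar>z p\<bar> \<le> C" and D: "\<And>p. p \<in> ?Q \<Longrightarrow> \<bar>g p\<bar> \<le> D"
      using continuous_on_Q_rectD(2)[OF z] continuous_on_Q_rectD(2)[OF gc] by blast
    obtain L where L: "continuous_on UNIV L"
      "\<And>\<nu>'. \<nu>' \<in> ?B \<Longrightarrow> signed_integral ?Q \<nu>' g = L (moments T \<nu>')"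
      using shift_polynomial_moments[OF gp, of T] by blast
    have near: "\<bar>signed_integral ?Q \<nu>' z - L (moments T \<nu>')\<bar> \<le> \<epsilon> / 3" if \<nu>': "\<nu>' \<in> ?B" for \<nu>'
    proof -
      have m: "z \<in> borel_measurable (borel_on ?Q)" "g \<in> borel_measurable (borel_on ?Q)"
        by (intro continuous_on_Q_rectD z gc)+
      have "signed_integral ?Q \<nu>' z - signed_integral ?Q \<nu>' g = signed_integral ?Q \<nu>' (\<lambda>p. z p - g p)"
        by (rule signed_integral_diff[OF \<nu>' m(1) C m(2) D, symmetric])
      also have "\<bar>\<dots>\<bar> \<le> 2 * R * \<delta>"
        using m g(2) \<delta> by (intro signed_integral_bound[OF \<nu>']) (auto intro: less_imp_le)
      also have "\<dots> \<le> \<epsilon> / 3"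
        using \<epsilon>(1) R by (simp add: \<delta>_def divide_simps)
      finally show ?thesis by (simp add: L(2)[OF \<nu>'])
    qed
    let ?W = "{w. \<bar>L w - L (moments T \<nu>)\<bar> < \<epsilon> / 3}"
    have "open ?W"
      by (intro open_Collect_less continuous_intros L(1))
    moreover have "signed_integral ?Q \<nu>' z \<in> U" if "\<nu>' \<in> ?B" "moments T \<nu>' \<in> ?W" for \<nu>'
    proof -
      have "\<bar>L (moments T \<nu>') - L (moments T \<nu>)\<bar> < \<epsilon> / 3" using that(2) by simp
      then show ?thesis using near[OF that(1)] near[OF \<nu>] by (intro \<epsilon>(2)) linarith
    qed
    ultimately have "?W \<in> ?\<W>" by (intro CollectI conjI ballI impI)
    moreover have "moments T \<nu> \<in> ?W" using \<epsilon>(1) by simp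
    ultimately show ?thesis by (rule rev_bexI)
  qed
  define V where "V = \<Union>?\<W>"
  have "open V" unfolding V_def by (intro open_Union) simp
  moreover have "signed_integral ?Q \<nu> z \<in> U \<longleftrightarrow> moments T \<nu> \<in> V" if \<nu>: "\<nu> \<in> ?B" for \<nu>
  proof
    assume "signed_integral ?Q \<nu> z \<in> U"
    from cover[OF \<nu> this] show "moments T \<nu> \<in> V" unfolding V_def by (rule bexE) (rule UnionI)
  next
    assume "moments T \<nu> \<in> V"
    then obtain W where "W \<in> ?\<W>" "moments T \<nu> \<in> W" unfolding V_def by (rule UnionE)
    with \<nu> show "signed_integral ?Q \<nu> z \<in> U" by simp
  qed
  ultimately show ?thesis by blast
qed

text \<open>
  Being cut out on the ball by an open condition on the moments is preserved under finite intersections and under arbitrary,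
  even uncountable, unions.
\<close>

lemma weak_star_open_moments:
  assumes G: "openin (weak_star (Q_rect T)) G" and R: "0 \<le> R"
  shows "\<exists>W. open W \<and> (\<forall>\<nu>\<in>signed_measures_le (Q_rect T) R. \<nu> \<in> G \<longleftrightarrow> moments T \<nu> \<in> W)"
proof -
  let ?B = "signed_measures_le (Q_rect T) R"
  from G show ?thesis
    unfolding weak_star_def openin_topology_generated_by_iff
  proof induction
    case Empty
    show ?case by (intro exI[of _ "{}"]) auto
  next
    case (Int G H)
    from Int.IH obtain V where V: "open V" "\<forall>\<nu>\<in>?B. \<nu> \<in> G \<longleftrightarrow> moments T \<nu> \<in> V" by blast
    from Int.IH obtain W where W: "open W" "\<forall>\<nu>\<in>?B. \<nu> \<in> H \<longleftrightarrow> moments T \<nu> \<in> W" by blast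
    show ?case using V W by (intro exI[of _ "V \<inter> W"]) (simp add: open_Int)
  next
    case (UN \<G>)
    then have "\<forall>G\<in>\<G>. \<exists>W. open W \<and> (\<forall>\<nu>\<in>?B. \<nu> \<in> G \<longleftrightarrow> moments T \<nu> \<in> W)" by blast
    from bchoice[OF this] obtain W where
      W: "\<forall>G\<in>\<G>. open (W G) \<and> (\<forall>\<nu>\<in>?B. \<nu> \<in> G \<longleftrightarrow> moments T \<nu> \<in> W G)" ..
    show ?case
    proof (intro exI[of _ "\<Union>G\<in>\<G>. W G"] conjI ballI)
      show "open (\<Union>G\<in>\<G>. W G)" by (intro open_UN ballI) (rule conjunct1[OF bspec[OF W]])
      fix \<nu> assume \<nu>: "\<nu> \<in> ?B"
      have "\<nu> \<in> \<Union>\<G> \<longleftrightarrow> (\<exists>G\<in>\<G>. \<nu> \<in> G)" by (rule Union_iff)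
      also have "\<dots> \<longleftrightarrow> (\<exists>G\<in>\<G>. moments T \<nu> \<in> W G)"
        by (rule bex_cong[OF refl]) (rule bspec[OF conjunct2[OF bspec[OF W]] \<nu>])
      also have "\<dots> \<longleftrightarrow> moments T \<nu> \<in> (\<Union>G\<in>\<G>. W G)" by (rule UN_iff[symmetric])
      finally show "\<nu> \<in> \<Union>\<G> \<longleftrightarrow> moments T \<nu> \<in> (\<Union>G\<in>\<G>. W G)" .
    qed
  next
    case (Basis G)
    from Basis obtain z and U :: "real set" where G: "G = {\<nu> \<in> signed_measures (Q_rect T). signed_integral (Q_rect T) \<nu> z \<in> U}"
      and zU: "continuous_on (Q_rect T) z" "open U" by blast
    have "\<nu> \<in> G \<longleftrightarrow> signed_integral (Q_rect T) \<nu> z \<in> U" if "\<nu> \<in> ?B" for \<nu>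
      using signed_measures_leD(1)[OF that] by (simp add: G)
    with weak_star_subbasic_moments[OF zU R] show ?case by simp
  qed
qed

lemma topspace_weak_star: "topspace (weak_star S) = signed_measures S"
proof -
  let ?\<S> = "{{\<nu> \<in> signed_measures S. signed_integral S \<nu> z \<in> U} | z U. continuous_on S z \<and> open U}"
  have "signed_measures S \<in> ?\<S>"
    by (intro CollectI exI[of _ "\<lambda>_. 0"] exI[of _ UNIV]) auto
  then have "\<Union>?\<S> = signed_measures S" by blast
  then show ?thesis by (simp add: weak_star_def)
qed

text \<open>
  The weak-* Borel sets are generated by arbitrary unions of subbasic sets, and a \<open>\<sigma>\<close>-algebra is only closed
  under countable ones. This gap is bridged by the second countability of the space of moment sequences: a
  map with measurable coordinates is Borel measurable into it, so preimages of all its open sets are measurable.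
\<close>

lemma measurable_weak_star_of_moments:
  assumes N: "\<And>m. m \<in> space M \<Longrightarrow> N m \<in> signed_measures_le (Q_rect T) R" and R: "0 \<le> R"
    and mom: "\<And>k. (\<lambda>m. moments T (N m) k) \<in> borel_measurable M"
  shows "N \<in> M \<rightarrow>\<^sub>M borel_of_topology (weak_star (Q_rect T))"
  unfolding borel_of_topology_def
proof (rule measurable_measure_of)
  show "{U. openin (weak_star (Q_rect T)) U} \<subseteq> Pow (topspace (weak_star (Q_rect T)))"
    by (auto dest: openin_subset)
  show "N \<in> space M \<rightarrow> topspace (weak_star (Q_rect T))"
    using N by (auto simp: topspace_weak_star dest: signed_measures_leD(1))
  fix G assume "G \<in> {U. openin (weak_star (Q_rect T)) U}"
  then have "openin (weak_star (Q_rect T)) G" by simp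
  from weak_star_open_moments[OF this R] obtain W where W: "open W"
    "\<forall>\<nu>\<in>signed_measures_le (Q_rect T) R. \<nu> \<in> G \<longleftrightarrow> moments T \<nu> \<in> W"
    by (elim exE conjE)
  have "(\<lambda>m. moments T (N m)) \<in> borel_measurable M"
    using mom by (rule measurable_coordinatewise_then_product)
  then have "(\<lambda>m. moments T (N m)) -` W \<inter> space M \<in> sets M"
    using W(1) by (intro measurable_sets) auto
  also have "(\<lambda>m. moments T (N m)) -` W \<inter> space M = N -` G \<inter> space M"
  proof -
    have "N m \<in> G \<longleftrightarrow> moments T (N m) \<in> W" if "m \<in> space M" for m
      by (rule bspec[OF W(2) N[OF that]])
    then show ?thesis by auto
  qed
  finally show "N -` G \<inter> space M \<in> sets M" .
qed

lemma measurable_signed_integral_weak_star: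
  assumes N: "N \<in> M \<rightarrow>\<^sub>M borel_of_topology (weak_star S)" and z: "continuous_on S z"
  shows "(\<lambda>m. signed_integral S (N m) z) \<in> borel_measurable M"
proof (rule borel_measurableI)
  fix U :: "real set" assume U: "open U"
  let ?G = "{\<nu> \<in> signed_measures S. signed_integral S \<nu> z \<in> U}"
  have Pow: "{G. openin (weak_star S) G} \<subseteq> Pow (signed_measures S)"
    unfolding topspace_weak_star[symmetric] by (intro subsetI PowI openin_subset) simp
  have "openin (weak_star S) ?G"
    unfolding weak_star_def using z U by (intro topology_generated_by_Basis) blast
  then have "?G \<in> sets (borel_of_topology (weak_star S))"
    unfolding borel_of_topology_def topspace_weak_star sets_measure_of[OF Pow]
    by (intro sigma_sets.Basic) simp
  from measurable_sets[OF N this] have "N -` ?G \<inter> space M \<in> sets M" .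
  also have "N -` ?G \<inter> space M = (\<lambda>m. signed_integral S (N m) z) -` U \<inter> space M"
  proof -
    have "N m \<in> signed_measures S" if "m \<in> space M" for m
      using measurable_space[OF N that] unfolding borel_of_topology_def topspace_weak_star space_measure_of_conv .
    then show ?thesis by auto
  qed
  finally show "(\<lambda>m. signed_integral S (N m) z) -` U \<inter> space M \<in> sets M" .
qed

section \<open>From primitives to weighted integrals\<close>

lemma integral_lebesgue_on_subinterval:
  fixes g :: "real \<Rightarrow> real"
  assumes "t \<le> T"
  shows "(LINT \<tau>|lebesgue_on {0..t}. g \<tau>) = (LINT \<tau>|lebesgue_on {0..T}. indicator {..t} \<tau> * g \<tau>)"
proof -
  have "(\<lambda>\<tau>. indicator {0..t} \<tau> *\<^sub>R g \<tau>) = (\<lambda>\<tau>. indicator {0..T} \<tau> *\<^sub>R (indicator {..t} \<tau> * g \<tau>))"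
    using assms by (auto simp: indicator_def)
  then show ?thesis
    by (simp add: integral_restrict_space)
qed

text \<open>
  Measurability in the parameter \<open>m\<close> of the primitives \<open>t \<mapsto> \<integral>\<^sub>0\<^sup>t g\<close> means measurability for the weights
  that are indicators of half-lines. Half-lines generate the Borel sets, and nonnegative bounded
  Borel weights are monotone limits of simple ones.
\<close>

lemma weighted_integral_measurable:
  fixes g :: "'a \<Rightarrow> real \<Rightarrow> real"
  assumes g: "\<And>m. m \<in> space M \<Longrightarrow> g m \<in> borel_measurable (lebesgue_on {0..T})"
      "\<And>m. m \<in> space M \<Longrightarrow> \<exists>B. \<forall>\<tau>\<in>{0..T}. \<bar>g m \<tau>\<bar> \<le> B" 
    and prim: "\<And>t. t \<in> {0..T} \<Longrightarrow> (\<lambda>m. LINT \<tau>|lebesgue_on {0..t}. g m \<tau>) \<in> borel_measurable M"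
    and T: "0 \<le> T"
    and h: "h \<in> borel_measurable borel" "\<And>\<tau>. 0 \<le> h \<tau>" "\<exists>C. \<forall>\<tau>\<in>{0..T}. h \<tau> \<le> C"
  shows "(\<lambda>m. LINT \<tau>|lebesgue_on {0..T}. h \<tau> * g m \<tau>) \<in> borel_measurable M"
proof -
  let ?L = "lebesgue_on {0..T}"
  have bm: "u \<in> borel_measurable ?L" if "u \<in> borel_measurable borel" for u :: "real \<Rightarrow> real"
    using that by (intro measurable_restrict_space1) (simp add: measurable_completion)
  have int: "integrable ?L (\<lambda>\<tau>. u \<tau> * g m \<tau>)"
    if m: "m \<in> space M" and u: "u \<in> borel_measurable borel" "\<And>\<tau>. \<tau> \<in> {0..T} \<Longrightarrow> \<bar>u \<tau>\<bar> \<le> C" for u m C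
  proof -
    obtain B where B: "\<And>\<tau>. \<tau> \<in> {0..T} \<Longrightarrow> \<bar>g m \<tau>\<bar> \<le> B" using g(2)[OF m] by blast
    have "\<bar>u \<tau> * g m \<tau>\<bar> \<le> C * B" if "\<tau> \<in> {0..T}" for \<tau>
      using u(2)[OF that] B[OF that] unfolding abs_mult by (intro mult_mono) auto
    then show ?thesis
      by (intro integrable_lebesgue_on_bounded[where C = "C * B"] borel_measurable_times bm u g(1)[OF m])
  qed
  have lim: "(\<lambda>m. LINT \<tau>|?L. u \<tau> * g m \<tau>) \<in> borel_measurable M"
    if U: "\<And>n. (U n :: real \<Rightarrow> real) \<in> borel_measurable borel" "\<And>n \<tau>. \<tau> \<in> {0..T} \<Longrightarrow> \<bar>U n \<tau>\<bar> \<le> C"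
      and u: "\<And>\<tau>. (\<lambda>n. U n \<tau>) \<longlonglongrightarrow> u \<tau>"
      and IH: "\<And>n. (\<lambda>m. LINT \<tau>|?L. U n \<tau> * g m \<tau>) \<in> borel_measurable M" for U u C
  proof (rule borel_measurable_LIMSEQ_real[OF _ IH])
    fix m assume m: "m \<in> space M"
    obtain B where B: "\<And>\<tau>. \<tau> \<in> {0..T} \<Longrightarrow> \<bar>g m \<tau>\<bar> \<le> B" using g(2)[OF m] by blast
    have um: "u \<in> borel_measurable borel"
      by (rule borel_measurable_LIMSEQ_real[OF _ U(1)]) (rule u)
    have le: "\<bar>U n \<tau> * g m \<tau>\<bar> \<le> C * B" if "\<tau> \<in> {0..T}" for n \<tau>
      using U(2)[OF that, of n] B[OF that] unfolding abs_mult by (intro mult_mono) auto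
    show "(\<lambda>n. LINT \<tau>|?L. U n \<tau> * g m \<tau>) \<longlonglongrightarrow> (LINT \<tau>|?L. u \<tau> * g m \<tau>)"
    proof (rule integral_dominated_convergence[where w = "\<lambda>_. C * B"])
      show "integrable ?L (\<lambda>_. C * B)"
        by (rule integrable_lebesgue_on_bounded[where C = "\<bar>C * B\<bar>"]) auto
      show "AE \<tau> in ?L. (\<lambda>n. U n \<tau> * g m \<tau>) \<longlonglongrightarrow> u \<tau> * g m \<tau>"
        by (intro AE_I2 tendsto_intros u)
      show "AE \<tau> in ?L. norm (U n \<tau> * g m \<tau>) \<le> C * B" for n
        by (intro AE_I2) (use le in simp)
    qed (intro borel_measurable_times bm um U g(1)[OF m])+
  qed
  have sets_case: "(\<lambda>m. LINT \<tau>|?L. indicator A \<tau> * g m \<tau>) \<in> borel_measurable M" if A: "A \<in> sets borel" for A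
  proof -
    let ?G = "range (\<lambda>a :: real. {..a})"
    have borel: "sets borel = sigma_sets UNIV ?G"
      by (subst borel_eq_atMost) simp
    have "Int_stable ?G" by (auto simp: Int_stable_def)
    moreover have "?G \<subseteq> Pow UNIV" by simp
    moreover have "A \<in> sigma_sets UNIV ?G" using A borel by simp
    ultimately show ?thesis
    proof (induction rule: sigma_sets_induct_disjoint)
      case (basic A)
      then obtain a where A: "A = {..a}" by blast
      show ?case
      proof (cases "0 \<le> a")
        case True
        have "(\<lambda>m. LINT \<tau>|lebesgue_on {0..min a T}. g m \<tau>) \<in> borel_measurable M"
          by (rule prim) (use True T in auto)
        also have "(\<lambda>m. LINT \<tau>|lebesgue_on {0..min a T}. g m \<tau>) = (\<lambda>m. LINT \<tau>|?L. indicator {..a} \<tau> * g m \<tau>)"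
          by (subst integral_lebesgue_on_subinterval[of _ T], simp, intro ext Bochner_Integration.integral_cong)
            (auto simp: indicator_def)
        finally show ?thesis unfolding A .
      next
        case False
        have "(LINT \<tau>|?L. indicator {..a} \<tau> * g m \<tau>) = (LINT \<tau>|?L. 0)" for m
          by (rule Bochner_Integration.integral_cong) (use False in \<open>auto simp: indicator_def\<close>)
        then show ?thesis unfolding A by simp
      qed
    next
      case (compl A)
      have "(\<lambda>m. (LINT \<tau>|?L. g m \<tau>) - (LINT \<tau>|?L. indicator A \<tau> * g m \<tau>)) \<in> borel_measurable M"
        using prim[of T] T compl by (intro borel_measurable_diff) auto
      moreover have "(LINT \<tau>|?L. indicator (UNIV - A) \<tau> * g m \<tau>) =
          (LINT \<tau>|?L. g m \<tau>) - (LINT \<tau>|?L. indicator A \<tau> * g m \<tau>)" if "m \<in> space M" for m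
      proof -
        have Ab: "A \<in> sets borel" using compl borel by simp
        have i1: "integrable ?L (\<lambda>\<tau>. 1 * g m \<tau>)" by (rule int[OF that, where C = 1]) auto
        have iA: "integrable ?L (\<lambda>\<tau>. indicator A \<tau> * g m \<tau>)" 
          by (rule int[OF that, where C = 1]) (use Ab in \<open>auto simp: indicator_def\<close>)
        have "(LINT \<tau>|?L. indicator (UNIV - A) \<tau> * g m \<tau>) = (LINT \<tau>|?L. 1 * g m \<tau> - indicator A \<tau> * g m \<tau>)"
          by (rule Bochner_Integration.integral_cong) (auto simp: indicator_def)
        also have "\<dots> = (LINT \<tau>|?L. 1 * g m \<tau>) - (LINT \<tau>|?L. indicator A \<tau> * g m \<tau>)"
          by (rule Bochner_Integration.integral_diff[OF i1 iA])
        finally show ?thesis by simp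
      qed
      ultimately show ?case by (subst measurable_cong) auto
    next
      case (union A)
      have Ab: "A i \<in> sets borel" for i using union borel by auto
      show ?case
      proof (rule lim[where U = "\<lambda>n. indicator (\<Union>i<n. A i)" and C = 1])
        show "(\<lambda>n. indicator (\<Union>i<n. A i) \<tau> :: real) \<longlonglongrightarrow> indicator (\<Union>i. A i) \<tau>" for \<tau>
          by (rule LIMSEQ_indicator_UN)
        show "(\<lambda>m. LINT \<tau>|?L. indicator (\<Union>i<n. A i) \<tau> * g m \<tau>) \<in> borel_measurable M" for n
        proof -
          have "(\<lambda>m. \<Sum>i<n. (LINT \<tau>|?L. indicator (A i) \<tau> * g m \<tau>)) \<in> borel_measurable M"
            by (intro borel_measurable_sum union)
          moreover have "(LINT \<tau>|?L. indicator (\<Union>i<n. A i) \<tau> * g m \<tau>) =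
              (\<Sum>i<n. (LINT \<tau>|?L. indicator (A i) \<tau> * g m \<tau>))" if "m \<in> space M" for m
          proof -
            have iA: "integrable ?L (\<lambda>\<tau>. indicator (A i) \<tau> * g m \<tau>)" for i
              by (rule int[OF that, where C = 1]) (use Ab in \<open>auto simp: indicator_def\<close>)
            have "indicator (\<Union>i<n. A i) \<tau> = (\<Sum>i<n. indicator (A i) \<tau> :: real)" for \<tau>
              by (rule indicator_UN_disjoint) (use union(1) in \<open>auto simp: disjoint_family_on_def\<close>)
            then have "(LINT \<tau>|?L. indicator (\<Union>i<n. A i) \<tau> * g m \<tau>) = (LINT \<tau>|?L. (\<Sum>i<n. indicator (A i) \<tau> * g m \<tau>))"
              by (simp add: sum_distrib_right)
            also have "\<dots> = (\<Sum>i<n. (LINT \<tau>|?L. indicator (A i) \<tau> * g m \<tau>))"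
              by (rule Bochner_Integration.integral_sum[OF iA])
            finally show ?thesis .
          qed
          ultimately show ?thesis by (subst measurable_cong) auto
        qed
      qed (use Ab in \<open>auto simp: indicator_def\<close>)
    qed simp
  qed
  from h show ?thesis
  proof (induction rule: borel_measurable_induct_real)
    case (set A)
    then show ?case by (intro sets_case)
  next
    case (mult u c)
    show ?case
    proof (cases "c = 0")
      case False
      with mult(1) have c: "0 < c" by simp
      from mult.prems obtain C where C: "\<forall>\<tau>\<in>{0..T}. c * u \<tau> \<le> C" by blast
      have "\<forall>\<tau>\<in>{0..T}. u \<tau> \<le> C / c"
        using C c by (metis mult.commute pos_le_divide_eq)
      then have "(\<lambda>m. LINT \<tau>|?L. u \<tau> * g m \<tau>) \<in> borel_measurable M" using mult.IH by blast
      then have "(\<lambda>m. c * (LINT \<tau>|?L. u \<tau> * g m \<tau>)) \<in> borel_measurable M"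
        by (intro borel_measurable_times) auto
      then show ?thesis by (simp add: mult.assoc)
    qed simp
  next
    case (add u v)
    from add.prems obtain C where C: "\<And>\<tau>. \<tau> \<in> {0..T} \<Longrightarrow> v \<tau> + u \<tau> \<le> C" by blast
    have Cu: "\<bar>u \<tau>\<bar> \<le> C" and Cv: "\<bar>v \<tau>\<bar> \<le> C" if "\<tau> \<in> {0..T}" for \<tau>
      using C[OF that] add.hyps(2)[of \<tau>] add.hyps(4)[of \<tau>] by linarith+
    have "(\<lambda>m. LINT \<tau>|?L. u \<tau> * g m \<tau>) \<in> borel_measurable M" "(\<lambda>m. LINT \<tau>|?L. v \<tau> * g m \<tau>) \<in> borel_measurable M"
      using add.IH Cu Cv abs_le_D1 by blast+
    then have "(\<lambda>m. (LINT \<tau>|?L. v \<tau> * g m \<tau>) + (LINT \<tau>|?L. u \<tau> * g m \<tau>)) \<in> borel_measurable M"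
      by (intro borel_measurable_add)
    moreover have "(LINT \<tau>|?L. (v \<tau> + u \<tau>) * g m \<tau>) = (LINT \<tau>|?L. v \<tau> * g m \<tau>) + (LINT \<tau>|?L. u \<tau> * g m \<tau>)"
      if "m \<in> space M" for m
      unfolding distrib_right
      by (rule Bochner_Integration.integral_add[OF int[OF that add.hyps(3) Cv] int[OF that add.hyps(1) Cu]])
    ultimately show ?case by (subst measurable_cong) auto
  next
    case (seq U)
    from seq.prems obtain C where C: "\<And>\<tau>. \<tau> \<in> {0..T} \<Longrightarrow> h \<tau> \<le> C" by blast
    have le: "U n \<tau> \<le> h \<tau>" for n \<tau>
    proof (rule incseq_le)
      show "incseq (\<lambda>n. U n \<tau>)" using seq.hyps(3) by (metis incseq_def le_funD)
      show "(\<lambda>n. U n \<tau>) \<longlonglongrightarrow> h \<tau>" using seq.hyps by simp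
    qed
    have CU: "\<bar>U n \<tau>\<bar> \<le> C" if "\<tau> \<in> {0..T}" for n \<tau>
      using C[OF that] le[of n \<tau>] seq.hyps(2)[of n \<tau>] by linarith
    show ?case
    proof (rule lim[where U = U and C = C])
      show "(\<lambda>m. LINT \<tau>|?L. U n \<tau> * g m \<tau>) \<in> borel_measurable M" for n
        using seq.IH[of n] CU[of _ n] abs_le_D1 by blast
    qed (use seq.hyps CU in auto)
  qed
qed

section \<open>Absolutely continuous functions\<close>

text \<open>
  The definition with a single interval.
\<close>

lemma absolutely_continuous_imp_continuous_on:
  assumes "absolutely_continuous_fun_on {a..b} x"
  shows "continuous_on {a..b} x"
  unfolding continuous_on_iff
proof (intro ballI allI impI)
  fix u and \<epsilon> :: real assume u: "u \<in> {a..b}" and \<epsilon>: "0 < \<epsilon>"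
  from assms[unfolded absolutely_continuous_fun_on_def, rule_format, OF \<epsilon>]
  obtain \<delta> where \<delta>: "\<delta> > 0" and ac: "\<forall>(n::nat) c d. (\<forall>k<n. c k \<le> d k \<and> {c k..d k} \<subseteq> {a..b}) \<longrightarrow>
      disjoint_family_on (\<lambda>k. {c k<..<d k}) {..<n} \<longrightarrow> (\<Sum>k<n. d k - c k) < \<delta> \<longrightarrow>
      (\<Sum>k<n. \<bar>x (d k) - x (c k)\<bar>) < \<epsilon>"
    by (elim exE conjE)
  have step: "\<bar>x d - x c\<bar> < \<epsilon>" if "c \<in> {a..b}" "d \<in> {a..b}" "c \<le> d" "d - c < \<delta>" for c d
    using ac[THEN spec[of _ 1], THEN spec[of _ "\<lambda>_. c"], THEN spec[of _ "\<lambda>_. d"]] that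
    by (auto simp: disjoint_family_on_def)
  have "dist (x v) (x u) < \<epsilon>" if v: "v \<in> {a..b}" "dist v u < \<delta>" for v
  proof (cases "u \<le> v")
    case True
    then show ?thesis using step[OF u v(1)] v(2) by (auto simp: dist_real_def)
  next
    case False
    then show ?thesis using step[OF v(1) u] v(2) by (auto simp: dist_real_def)
  qed
  then show "\<exists>\<delta>>0. \<forall>v\<in>{a..b}. dist v u < \<delta> \<longrightarrow> dist (x v) (x u) < \<epsilon>"
    using \<delta> by blast
qed

text \<open>
  By the mean value theorem powers are Lipschitz on a bounded interval.
\<close>

lemma absolutely_continuous_power: "absolutely_continuous_fun_on {a..b} (\<lambda>t :: real. t ^ j)"
proof -
  let ?M = "max \<bar>a\<bar> \<bar>b\<bar>"
  define L where "L = real j * ?M ^ (j - 1)"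
  have L: "0 \<le> L" by (simp add: L_def)
  have lip: "\<bar>d ^ j - c ^ j\<bar> \<le> L * \<bar>d - c\<bar>" if cd: "c \<in> {a..b}" "d \<in> {a..b}" for c d :: real
  proof -
    have "norm (d ^ j - c ^ j) \<le> L * norm (d - c)"
    proof (rule field_differentiable_bound[where S = "{a..b}" and f' = "\<lambda>t. real j * t ^ (j - 1)"])
      fix t assume "t \<in> {a..b}"
      show "((\<lambda>t. t ^ j) has_field_derivative real j * t ^ (j - 1)) (at t within {a..b})"
        by (auto intro!: derivative_eq_intros)
      have "\<bar>t\<bar> \<le> ?M" using \<open>t \<in> _\<close> by auto
      then show "norm (real j * t ^ (j - 1)) \<le> L"
        by (auto simp: L_def abs_mult power_abs intro!: mult_left_mono power_mono)
    qed (use cd in auto)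
    then show ?thesis by simp
  qed
  show ?thesis
    unfolding absolutely_continuous_fun_on_def
  proof (intro allI impI)
    \<comment> \<open>With a Lipschitz constant \<open>L\<close> any \<open>\<delta>\<close> with \<open>L * \<delta> < \<epsilon>\<close> works; \<open>\<epsilon> / (L + 1)\<close> also covers \<open>L = 0\<close>.\<close>
    fix \<epsilon> :: real assume \<epsilon>: "0 < \<epsilon>"
    have "(\<Sum>k<n. \<bar>d k ^ j - c k ^ j\<bar>) < \<epsilon>"
      if cd: "\<forall>k<n. c k \<le> d k \<and> {c k..d k} \<subseteq> {a..b}" and s: "(\<Sum>k<n. d k - c k) < \<epsilon> / (L + 1)"
      for n :: nat and c d :: "nat \<Rightarrow> real"
    proof -
      have "(\<Sum>k<n. \<bar>d k ^ j - c k ^ j\<bar>) \<le> (\<Sum>k<n. L * (d k - c k))"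
      proof (rule sum_mono)
        fix k assume "k \<in> {..<n}"
        then have k: "c k \<le> d k" "{c k..d k} \<subseteq> {a..b}" using cd by auto
        then have "c k \<in> {a..b}" "d k \<in> {a..b}" by auto
        from lip[OF this] k(1) show "\<bar>d k ^ j - c k ^ j\<bar> \<le> L * (d k - c k)" by simp
      qed
      also have "\<dots> = L * (\<Sum>k<n. d k - c k)" by (simp add: sum_distrib_left)
      also have "\<dots> \<le> L * (\<epsilon> / (L + 1))" using s L by (intro mult_left_mono) auto
      also have "\<dots> < \<epsilon>" using \<epsilon> L by (simp add: divide_simps)
      finally show ?thesis .
    qed
    moreover have "\<epsilon> / (L + 1) > 0" using \<epsilon> L by simp
    ultimately show "\<exists>\<delta>>0. \<forall>(n::nat) c d. (\<forall>k<n. c k \<le> d k \<and> {c k..d k} \<subseteq> {a..b}) \<longrightarrow>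
       disjoint_family_on (\<lambda>k. {c k<..<d k}) {..<n} \<longrightarrow>
       (\<Sum>k<n. d k - c k) < \<delta> \<longrightarrow> (\<Sum>k<n. \<bar>d k ^ j - c k ^ j\<bar>) < \<epsilon>"
      by blast
  qed
qed

section \<open>The equivalence\<close>

lemma continuous_on_shift:
  assumes "continuous_on {-1..T} x"
  shows "continuous_on (Q_rect T) (\<lambda>p. x (fst p + snd p))"
  by (rule continuous_on_compose2[OF assms]) (auto simp: Q_rect_def intro!: continuous_intros)

theorem theorem7p1:
  fixes T K :: real
    and \<Sigma> :: "(real \<Rightarrow> real set \<Rightarrow> real) set set"
  assumes "T > 0" and "K > 0"
    and "sigma_algebra (m_maps T K) \<Sigma>"
  defines "cond_i \<equiv>
    (\<forall>x. absolutely_continuous_fun_on {-1..T} x \<longrightarrow> (\<forall>t\<in>{0..T}.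
      (\<lambda>\<mu>. LINT \<tau>|lebesgue_on {0..t}. signed_integral {-1..0} (\<mu> \<tau>) (\<lambda>s. x (\<tau> + s)))
        \<in> measurable (sigma (m_maps T K) \<Sigma>) borel))"
  defines "cond_ii \<equiv>
    nu T \<in> measurable (sigma (m_maps T K) \<Sigma>) (borel_of_topology (weak_star (Q_rect T)))"
  defines "cond_iii \<equiv>
    (\<forall>z. continuous_on (Q_rect T) z \<longrightarrow>
      (\<lambda>\<mu>. signed_integral (Q_rect T) (nu T \<mu>) z)
        \<in> measurable (sigma (m_maps T K) \<Sigma>) borel)"
  shows "(cond_i \<longleftrightarrow> cond_ii) \<and> (cond_ii \<longleftrightarrow> cond_iii)"
proof -
  let ?M = "sigma (m_maps T K) \<Sigma>" and ?L = "lebesgue_on {0..T}" and ?S = "{-1..0::real}"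
  have T: "0 \<le> T" and K: "0 \<le> K" using assms(1,2) by auto
  have "\<Sigma> \<subseteq> Pow (m_maps T K)"
    using assms(3) by (simp add: sigma_algebra_iff2)
  then have space: "space ?M = m_maps T K" by (rule space_measure_of)
  have step12: "cond_ii" if i: "cond_i"
    unfolding cond_ii_def
  proof (rule measurable_weak_star_of_moments)
    show "nu T \<mu> \<in> signed_measures_le (Q_rect T) (K * T)" if "\<mu> \<in> space ?M" for \<mu>
      using that nu_signed_measures_le[OF _ K T] by (simp add: space)
    show "0 \<le> K * T" using K T by simp
  next
    fix k :: "nat \<times> nat"
    let ?g = "\<lambda>\<mu> \<tau>. signed_integral ?S (\<mu> \<tau>) (\<lambda>s. (\<tau> + s) ^ snd k)"
    have c: "continuous_on (Q_rect T) (\<lambda>p. (fst p + snd p) ^ snd k)" by (intro continuous_intros)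
    \<comment> \<open>The weight \<open>\<tau>\<^sup>i\<close> is replaced by a function that is nonnegative on the whole line and agrees with it on \<open>[0,T]\<close>.\<close>
    have "(\<lambda>\<mu>. LINT \<tau>|?L. max 0 \<tau> ^ fst k * ?g \<mu> \<tau>) \<in> borel_measurable ?M"
    proof (rule weighted_integral_measurable[OF _ _ _ T])
      show "?g \<mu> \<in> borel_measurable ?L" if "\<mu> \<in> space ?M" for \<mu>
        using nu_fubini_continuous(2)[OF _ K T c] that by (simp add: space)
      show "\<exists>B. \<forall>\<tau>\<in>{0..T}. \<bar>?g \<mu> \<tau>\<bar> \<le> B" if "\<mu> \<in> space ?M" for \<mu>
        using nu_fubini_continuous(3)[OF _ K T c] that by (simp add: space)
      show "(\<lambda>\<mu>. LINT \<tau>|lebesgue_on {0..t}. ?g \<mu> \<tau>) \<in> borel_measurable ?M" if "t \<in> {0..T}" for t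
        using i that absolutely_continuous_power[of "-1" T "snd k"] unfolding cond_i_def by blast
      have "max 0 \<tau> ^ fst k \<le> T ^ fst k" if "\<tau> \<in> {0..T}" for \<tau> :: real
        using that by (intro power_mono) auto
      then show "\<exists>C. \<forall>\<tau>\<in>{0..T}. max 0 \<tau> ^ fst k \<le> C" by blast
    qed auto
    moreover have "moments T (nu T \<mu>) k = (LINT \<tau>|?L. max 0 \<tau> ^ fst k * ?g \<mu> \<tau>)" if "\<mu> \<in> space ?M" for \<mu>
    proof -
      have "moments T (nu T \<mu>) k = (LINT \<tau>|?L. signed_integral ?S (\<mu> \<tau>) (\<lambda>s. shift_monomial k (\<tau>, s)))"
        unfolding moments_def using that
        by (intro nu_fubini_continuous(1)[OF _ K T] continuous_on_shift_monomial) (simp add: space)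
      also have "\<dots> = (LINT \<tau>|?L. max 0 \<tau> ^ fst k * ?g \<mu> \<tau>)"
        by (rule Bochner_Integration.integral_cong) (auto simp: shift_monomial_def signed_integral_cmult)
      finally show ?thesis .
    qed
    ultimately show "(\<lambda>\<mu>. moments T (nu T \<mu>) k) \<in> borel_measurable ?M"
      by (subst measurable_cong) auto
  qed
  have step23: "cond_iii" if "cond_ii"
    using that measurable_signed_integral_weak_star unfolding cond_ii_def cond_iii_def by blast
  have step31: "cond_i" if iii: "cond_iii"
    unfolding cond_i_def
  proof (intro allI impI ballI)
    fix x t assume x: "absolutely_continuous_fun_on {-1..T} x" and t: "t \<in> {0..T}"
    let ?g = "\<lambda>\<mu> \<tau>. signed_integral ?S (\<mu> \<tau>) (\<lambda>s. x (\<tau> + s))"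
    \<comment> \<open>Condition (iii) needs continuous integrands, so the truncation to \<open>[0,t]\<close> is made by continuous cutoffs in \<open>\<tau>\<close>.\<close>
    let ?z = "\<lambda>n p. cutoff n t (fst p) * x (fst p + snd p)"
    have c: "continuous_on (Q_rect T) (\<lambda>p. x (fst p + snd p))"
      by (intro continuous_on_shift absolutely_continuous_imp_continuous_on x)
    have cz: "continuous_on (Q_rect T) (?z n)" for n
      by (intro continuous_intros c)
    show "(\<lambda>\<mu>. LINT \<tau>|lebesgue_on {0..t}. ?g \<mu> \<tau>) \<in> borel_measurable ?M"
    proof (rule borel_measurable_LIMSEQ_real)
      show "(\<lambda>\<mu>. signed_integral (Q_rect T) (nu T \<mu>) (?z n)) \<in> borel_measurable ?M" for n
        using iii cz unfolding cond_iii_def by blast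
      fix \<mu> assume "\<mu> \<in> space ?M"
      then have \<mu>: "\<mu> \<in> m_maps T K" by (simp add: space)
      have gm: "?g \<mu> \<in> borel_measurable ?L"
        using nu_fubini_continuous(2)[OF \<mu> K T c] by simp
      obtain B where B: "\<And>\<tau>. \<tau> \<in> {0..T} \<Longrightarrow> \<bar>?g \<mu> \<tau>\<bar> \<le> B"
        using nu_fubini_continuous(3)[OF \<mu> K T c] unfolding fst_conv snd_conv by blast
      have bm: "u \<in> borel_measurable ?L" if "u \<in> borel_measurable borel" for u :: "real \<Rightarrow> real"
        using that by (intro measurable_restrict_space1) (simp add: measurable_completion)
      have le: "\<bar>cutoff n t \<tau> * ?g \<mu> \<tau>\<bar> \<le> 1 * B" if "\<tau> \<in> {0..T}" for n \<tau>
        unfolding abs_mult using B[OF that] cutoff_bounds by (intro mult_mono) auto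
      have "(\<lambda>n. LINT \<tau>|?L. cutoff n t \<tau> * ?g \<mu> \<tau>) \<longlonglongrightarrow> (LINT \<tau>|?L. indicator {..t} \<tau> * ?g \<mu> \<tau>)"
      proof (rule integral_dominated_convergence[where w = "\<lambda>_. 1 * B"])
        show "integrable ?L (\<lambda>_. 1 * B)"
          by (rule integrable_lebesgue_on_bounded[where C = "\<bar>B\<bar>"]) auto
        show "AE \<tau> in ?L. (\<lambda>n. cutoff n t \<tau> * ?g \<mu> \<tau>) \<longlonglongrightarrow> indicator {..t} \<tau> * ?g \<mu> \<tau>"
          by (intro AE_I2 tendsto_intros cutoff_tendsto)
        show "AE \<tau> in ?L. norm (cutoff n t \<tau> * ?g \<mu> \<tau>) \<le> 1 * B" for n
          by (intro AE_I2) (use le in simp)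
        show "(\<lambda>\<tau>. indicator {..t} \<tau> * ?g \<mu> \<tau>) \<in> borel_measurable ?L"
          by (intro borel_measurable_times gm bm) auto
        show "(\<lambda>\<tau>. cutoff n t \<tau> * ?g \<mu> \<tau>) \<in> borel_measurable ?L" for n
          by (intro borel_measurable_times gm bm borel_measurable_continuous_onI continuous_intros)
      qed
      moreover have "signed_integral (Q_rect T) (nu T \<mu>) (?z n) = (LINT \<tau>|?L. cutoff n t \<tau> * ?g \<mu> \<tau>)" for n
        using nu_fubini_continuous(1)[OF \<mu> K T cz[of n]] by (simp add: signed_integral_cmult)
      ultimately show "(\<lambda>n. signed_integral (Q_rect T) (nu T \<mu>) (?z n)) \<longlonglongrightarrow>
          (LINT \<tau>|lebesgue_on {0..t}. ?g \<mu> \<tau>)"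
        using t by (simp add: integral_lebesgue_on_subinterval[of t T])
    qed
  qed
  show ?thesis using step12 step23 step31 by blast
qed

end
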